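(* Let $n$ be a positive integer and let $Z\in R=\mathbf{F}_q[T]$ be any non-constant polynomial. For the following series of monic square-free polynomials $D\in R$, the ideal class groups $H(D)$ of the real quadratic function fields $K=k(\sqrt{D})$ all contain a subgroup of order $n$: (1) $D=Z^{2n}+1$; (2) $D=(Z^n+F-1)^2+4F$, where $F\in R$ and $F\mid (Z^n-1)$; (3) $D=(Z^n-F+1)^2+4F$, where $F\in R$ and $F\mid (Z^n+1)$; (4) $D=(4Z^n+F-1)^2+4F$, where $F\in R$ and $F\mid (4Z^n-1)$. In general, for any such $D$ of the form $D=(Z^n+aF-b)^2+4abF$, where $a,b\in\mathbf{F}_q^\times$, $F\in R$ and $F\mid (Z^n-b)$, the ideal class group of $K=k(\sqrt{D})$ contains a subgroup of order $n$.
   Context: $\mathbf{F}_q$ is the finite field with $q$ elements, $q$ odd; $R=\mathbf{F}_q[T]$ and $k=\mathbf{F}_q(T)$. A real quadratic function field is $K=k(\sqrt{D})$ with $D\in R$ a non-constant square-free polynomial of even degree whose leading coefficient is a square in $\mathbf{F}_q^\times$ (in particular, this holds for $D$ monic square-free of positive even degree). $\mathcal{O}_K$ is the integral closure of $R$ in $K$. $H(K)=H(D)$ denotes the ideal class group of $\mathcal{O}_K$, i.e. the group of fractional ideals of $\mathcal{O}_K$ modulo principal fractional ideals.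
   Formalization: In (2), (3), (4) and the general form the polynomial being squared is assumed nonzero; otherwise the claim fails, e.g. q=5, n=2, Z=T, a=b=1, F=1-T^2 gives D=T^2-1 with trivial class group. *)

theory Defs
  imports
    "HOL-Algebra.Algebraic_Closure_Type"
    "HOL-Algebra.Generated_Fields"
    "HOL-Algebra.Coset"
begin

text \<open>
  The base field is a type of class field and finite; \<open>k\<close> is the fraction field
  \<open>'a poly fract\<close>. Every quadratic extension of \<open>k\<close> is realised as a subset of the
  algebraic closure type of \<open>k\<close>.
\<close>

definition of_R :: "'a::field poly \<Rightarrow> 'a poly fract alg_closure" where
  "of_R p = to_ac (to_fract p)"

text \<open>
  One of the two square roots of \<open>D\<close>; a square root exists because the closure is algebraically
  closed, and nothing below depends on the sign.
\<close>

definition sqrt_R :: "'a::field poly \<Rightarrow> 'a poly fract alg_closure" where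
  "sqrt_R D = (SOME s. s ^ 2 = of_R D)"

definition quad_field :: "'a::field poly \<Rightarrow> 'a poly fract alg_closure set" where
  "quad_field D = generate_field ring_of_type_algebra (insert (sqrt_R D) (range to_ac))"

definition real_quadratic :: "'a::field poly \<Rightarrow> bool" where
  "real_quadratic D \<longleftrightarrow>
     Polynomial.degree D > 0 \<and> squarefree D \<and> even (Polynomial.degree D) \<and>
     (\<exists>c. c \<noteq> 0 \<and> Polynomial.lead_coeff D = c ^ 2)"

definition integral_over_R :: "'a::field poly fract alg_closure \<Rightarrow> bool" where
  "integral_over_R z \<longleftrightarrow>
     (\<exists>p :: 'a poly poly. Polynomial.lead_coeff p = 1 \<and> poly (map_poly of_R p) z = 0)"

definition int_ring :: "'a::field poly \<Rightarrow> 'a poly fract alg_closure set" where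
  "int_ring D = {z \<in> quad_field D. integral_over_R z}"

definition fractional_ideal :: "'a::field poly \<Rightarrow> 'a poly fract alg_closure set \<Rightarrow> bool" where
  "fractional_ideal D I \<longleftrightarrow>
     I \<subseteq> quad_field D \<and> 0 \<in> I \<and> I \<noteq> {0} \<and>
     (\<forall>x\<in>I. \<forall>y\<in>I. x + y \<in> I) \<and> (\<forall>r\<in>int_ring D. \<forall>x\<in>I. r * x \<in> I) \<and>
     (\<exists>d\<in>int_ring D. d \<noteq> 0 \<and> (\<forall>x\<in>I. d * x \<in> int_ring D))"

definition ideal_mult :: "'b::comm_ring_1 set \<Rightarrow> 'b set \<Rightarrow> 'b set" where
  "ideal_mult I J =
     {\<Sum>i<m. f i * g i | (m::nat) f g. (\<forall>i<m. f i \<in> I) \<and> (\<forall>i<m. g i \<in> J)}"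

definition ideal_group :: "'a::field poly \<Rightarrow> 'a poly fract alg_closure set monoid" where
  "ideal_group D =
     \<lparr>carrier = {I. fractional_ideal D I}, monoid.mult = ideal_mult, one = int_ring D\<rparr>"

definition principal_ideals :: "'a::field poly \<Rightarrow> 'a poly fract alg_closure set set" where
  "principal_ideals D = {(\<lambda>r. x * r) ` int_ring D | x. x \<in> quad_field D \<and> x \<noteq> 0}"

definition class_group :: "'a::field poly \<Rightarrow> 'a poly fract alg_closure set set monoid" where
  "class_group D = ideal_group D Mod principal_ideals D"

definition has_subgroup_of_order :: "('b, 'c) monoid_scheme \<Rightarrow> nat \<Rightarrow> bool" where
  "has_subgroup_of_order G n \<longleftrightarrow> (\<exists>H. subgroup H G \<and> finite H \<and> card H = n)"

end

theory Submission
  imports Defs "HOL-Number_Theory.Residues"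
begin

text \<open>
  In every case \<open>D = Y\<^sup>2 - E Z\<^sup>n = S\<^sup>2 + F\<close> with a unit \<open>E\<close>, \<open>F\<close> dividing \<open>S\<close> and prime to \<open>Z\<close>,
  and \<open>deg S = n deg Z\<close>. The first representation shows that \<open>A\<^sub>i = (Z\<^sup>i, Y + \<surd>D)\<close> satisfies
  \<open>A\<^sub>i A\<^sub>j = A\<^sub>i\<^sub>+\<^sub>j\<close> for \<open>i + j \<le> n\<close> and that \<open>A\<^sub>n\<close> is principal, so the class of \<open>A\<^sub>1\<close> has order dividing \<open>n\<close>.
  A generator of \<open>A\<^sub>m\<close> with \<open>0 < m < n\<close> would be primitive of norm \<open>Z\<^sup>m\<close> up to a unit, of degree below
  \<open>deg S\<close>. The second representation amounts to a very short continued fraction of \<open>\<surd>D\<close> and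
  forces such a norm to divide \<open>F\<close>, which is prime to \<open>Z\<close>.
\<close>

section \<open>Small values of the norm form\<close>

text \<open>Coprimality carried as an explicit certificate: it makes sense in any commutative ring
  and passes through linear substitutions by rewriting the coefficients.\<close>

definition bezout :: "'a::comm_ring_1 \<Rightarrow> 'a \<Rightarrow> bool" where
  "bezout p q \<longleftrightarrow> (\<exists>a b. a * p + b * q = 1)"

lemma bezout_sym: "bezout p q \<Longrightarrow> bezout q p"
  unfolding bezout_def by (metis add.commute)

lemma bezout_mult_right:
  assumes "bezout p q" "bezout p r"
  shows "bezout p (q * r)"
proof -
  obtain a b c d where "a * p + b * q = 1" "c * p + d * r = 1"
    using assms unfolding bezout_def by blast
  then have "(a * p + b * q) * (c * p + d * r) = 1" by simp
  then have "(a * (c * p + d * r) + b * q * c) * p + (b * d) * (q * r) = 1"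
    by (simp add: algebra_simps)
  then show ?thesis unfolding bezout_def by blast
qed

lemma bezout_power_right: "bezout p q \<Longrightarrow> bezout p (q ^ n)"
proof (induction n)
  case 0
  have "0 * p + 1 * q ^ 0 = 1" by simp
  then show ?case unfolding bezout_def by blast
qed (simp add: bezout_mult_right)

lemma bezout_power_left: "bezout p q \<Longrightarrow> bezout (p ^ n) q"
  using bezout_power_right bezout_sym by blast

lemma bezout_powers: "bezout p q \<Longrightarrow> bezout (q ^ i) (p ^ j)"
  by (rule bezout_power_left[OF bezout_power_right[OF bezout_sym]])

lemma bezout_dvd_left:
  assumes "bezout p q" "p' dvd p"
  shows "bezout p' q"
proof -
  obtain a b k where "a * p + b * q = 1" "p = p' * k"
    using assms unfolding bezout_def dvd_def by blast
  then have "(a * k) * p' + b * q = 1" by (simp add: mult.commute mult.left_commute)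
  then show ?thesis unfolding bezout_def by blast
qed

lemma bezout_dvd_mult:
  assumes "bezout p q" "p dvd q * r"
  shows "p dvd r"
proof -
  obtain a b where "a * p + b * q = 1" using assms(1) unfolding bezout_def by blast
  then have "a * p * r + b * q * r = r" by (metis distrib_right mult_1)
  moreover have "p dvd a * p * r + b * q * r"
    using assms(2) by (simp add: mult.assoc)
  ultimately show ?thesis by simp
qed

lemma bezout_self_dvd: "bezout p q \<Longrightarrow> p dvd q \<Longrightarrow> p dvd 1"
  using bezout_dvd_mult[of p q 1] by simp

text \<open>Euclid's algorithm: a common factor of \<open>q\<close> and \<open>p mod q\<close> with
  comaximal cofactors is also one for \<open>p\<close> and \<open>q\<close>, and the quotient
  updates the certificate.\<close>

lemma bezout_decomposition:
  fixes p q :: "'a::euclidean_ring"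
  shows "\<exists>g p' q'. p = g * p' \<and> q = g * q' \<and> bezout p' q'"
proof (induction "euclidean_size q" arbitrary: p q rule: less_induct)
  case less
  show ?case
  proof (cases "q = 0")
    case True
    have "bezout 1 (0::'a)" unfolding bezout_def by (rule exI[of _ 1]) simp
    then show ?thesis using True by (intro exI[of _ p] exI[of _ 1] exI[of _ 0]) simp
  next
    case False
    obtain g q' r' where g: "q = g * q'" "p mod q = g * r'" "bezout q' r'"
      using less[OF mod_size_less[OF False]] by blast
    obtain a b where ab: "a * q' + b * r' = 1" using g(3) unfolding bezout_def by blast
    define d where "d = p div q"
    have "p = q * d + p mod q" by (simp add: d_def)
    also have "\<dots> = g * (q' * d + r')"
      by (subst g(2), subst g(1)) (simp add: algebra_simps)
    finally have p: "p = g * (q' * d + r')" .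
    have "b * (q' * d + r') + (a - b * d) * q' = 1"
      using ab by (simp add: algebra_simps)
    then have "bezout (q' * d + r') q'" unfolding bezout_def by blast
    with p g(1) show ?thesis by blast
  qed
qed

lemma two_invertible_poly:
  assumes "(2::'a::field) \<noteq> 0"
  obtains h :: "'a::field poly" where "2 * h = 1"
proof -
  have "[:2:] * [:inverse 2:] = (1 :: 'a poly)" using assms by simp
  then have "2 * [:inverse 2:] = (1 :: 'a poly)" by (simp only: numeral_poly)
  then show ?thesis using that by blast
qed

lemma degree_mult_less_cancel:
  fixes p q :: "'a::field poly"
  assumes "p \<noteq> 0" and "Polynomial.degree (p * q) < Polynomial.degree p + m"
  shows "q = 0 \<or> Polynomial.degree q < m"
  using assms by (cases "q = 0") (auto simp: degree_mult_eq)

text \<open>The descent applies the two reflections \<open>r \<mapsto> -(r + 2Sq)\<close> and \<open>q \<mapsto> 2Gr - q\<close>, which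
  preserve the form \<open>r\<^sup>2 + 2Sqr - Fq\<^sup>2\<close>; a small value forces a cancellation of leading terms,
  so that one of them decreases a degree.\<close>

lemma small_form_value_dvd:
  fixes S F G q r :: "'a::field poly"
  assumes "S = F * G" "S \<noteq> 0" "(2::'a) \<noteq> 0" "bezout q r"
    and "Polynomial.degree (r ^ 2 + 2 * S * q * r - F * q ^ 2) < Polynomial.degree S"
  shows "(r ^ 2 + 2 * S * q * r - F * q ^ 2) dvd F"
proof -
  \<comment> \<open>\<open>degree\<close> is 0 both for the zero polynomial and for constants; the
    shift by one makes the measure drop when a reflection turns a nonzero constant into 0.\<close>
  define sz where "sz p = (if p = 0 then 0 else Suc (Polynomial.degree p))" for p :: "'a poly"
  have sz_less: "sz x < sz y" if "x = 0 \<or> Polynomial.degree x < Polynomial.degree y" "y \<noteq> 0" for x y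
    using that by (auto simp: sz_def)
  have sz_minus: "sz (- x) = sz x" for x by (simp add: sz_def)
  have G0: "G \<noteq> 0" and F0: "F \<noteq> 0" using assms(1,2) by auto
  have two: "(2::'a poly) \<noteq> 0" "Polynomial.degree (2::'a poly) = 0"
    using assms(3) by (metis one_add_one degree_1 degree_numeral numeral_poly pCons_eq_0_iff, simp)
  have dS: "Polynomial.degree S = Polynomial.degree F + Polynomial.degree G"
    using assms(1) G0 F0 by (simp add: degree_mult_eq)
  show ?thesis using assms(4,5)
  proof (induction "sz r + sz q" arbitrary: q r rule: less_induct)
    case less
    let ?N = "r ^ 2 + 2 * S * q * r - F * q ^ 2"
    consider "r = 0" | "q = 0" | "r \<noteq> 0" "q \<noteq> 0" by blast
    then show ?case
    proof cases
      case 1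
      then have "q dvd 1" using less.prems(1) unfolding bezout_def
        by (metis add.right_neutral dvd_triv_right mult_zero_right)
      then have "q ^ 2 dvd 1" by (metis dvd_power_same power_one)
      then have "F * q ^ 2 dvd F" by (metis mult.right_neutral mult_dvd_mono dvd_refl)
      then show ?thesis using 1 by simp
    next
      case 2
      then have "r dvd 1" using less.prems(1) unfolding bezout_def
        by (metis add.left_neutral dvd_triv_right mult_zero_right)
      then have "r ^ 2 dvd 1" by (metis dvd_power_same power_one)
      then show ?thesis using 2 dvd_trans one_dvd by auto
    next
      case 3
      define a where "a = Polynomial.degree r"
      define k where "k = Polynomial.degree q"
      define d where "d = Polynomial.degree S"
      define f where "f = Polynomial.degree F"
      have fd: "f \<le> d" using dS by (simp add: f_def d_def)
      have d0: "0 < d" using less.prems(2) by (simp add: d_def)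
      let ?A = "r ^ 2" and ?B = "2 * S * q * r" and ?E = "- (F * q ^ 2)"
      have degs: "Polynomial.degree ?A = 2 * a" "Polynomial.degree ?B = d + k + a"
        "Polynomial.degree ?E = f + 2 * k"
        using 3 assms(2) two F0
        by (simp_all add: degree_mult_eq degree_power_eq a_def k_def d_def f_def)
      have small: "Polynomial.degree (?A + ?B + ?E) < d" using less.prems(2) by (simp add: d_def)
      \<comment> \<open>The three terms have degrees \<open>2 * a\<close>, \<open>d + k + a\<close>
        and \<open>f + 2 * k\<close>. In cases 1, 3 and 5 one of them strictly dominates and the
        value has degree at least \<open>d\<close>; in cases 2 and 4 the two top terms tie and must
        cancel.\<close>
      consider "a > k + d" | "a = k + d" | "a < k + d" "k + f > a + d"
        | "a < k + d" "k + f = a + d" | "a < k + d" "k + f < a + d"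
        by linarith
      then show ?thesis
      proof cases
        case 1
        have "Polynomial.degree (?A + (?B + ?E)) = Polynomial.degree ?A"
          by (rule degree_add_eq_left, rule le_less_trans[OF degree_add_le_max]) (use degs 1 fd d0 in auto)
        then have "Polynomial.degree (?A + ?B + ?E) = 2 * a" by (simp only: add.assoc degs)
        then have False using small 1 by linarith
        then show ?thesis ..
      next
        case 2
        have "Polynomial.degree (?A + ?B) < 2 * a"
        proof (rule ccontr)
          assume big: "\<not> ?thesis"
          then have "Polynomial.degree (?A + ?B + ?E) = Polynomial.degree (?A + ?B)"
            using degs 2 fd d0 by (intro degree_add_eq_left) auto
          then show False using small big 2 by linarith
        qed
        \<comment> \<open>The reflection of \<open>r\<close> negates and exchanges these two
          factors, which is why the form is unchanged.\<close>
        moreover have "?A + ?B = r * (r + 2 * S * q)" by (simp add: power2_eq_square algebra_simps)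
        ultimately have "Polynomial.degree (r * (r + 2 * S * q)) < Polynomial.degree r + a"
          by (simp only: a_def mult_2)
        then have "r + 2 * S * q = 0 \<or> Polynomial.degree (r + 2 * S * q) < a"
          by (rule degree_mult_less_cancel[OF 3(1)])
        then have "sz (- (r + 2 * S * q)) < sz r"
          unfolding sz_minus a_def by (rule sz_less) (rule 3)
        then have meas: "sz (- (r + 2 * S * q)) + sz q < sz r + sz q" by simp
        obtain x y where "x * q + y * r = 1" using less.prems(1) unfolding bezout_def by blast
        then have "(x - 2 * S * y) * q + (- y) * (- (r + 2 * S * q)) = 1"
          by (simp add: algebra_simps)
        then have bz: "bezout q (- (r + 2 * S * q))" unfolding bezout_def by blast
        have "(- (r + 2 * S * q)) ^ 2 + 2 * S * q * (- (r + 2 * S * q)) - F * q ^ 2 = ?N"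
          by (simp add: power2_eq_square algebra_simps)
        then show ?thesis using less.hyps[OF meas bz] less.prems(2) by (simp only:)
      next
        case gt: 3
        have "Polynomial.degree ((?A + ?B) + ?E) = Polynomial.degree ?E"
          by (rule degree_add_eq_right, rule le_less_trans[OF degree_add_le_max]) (use degs gt fd d0 in auto)
        then have False using small degs gt by linarith
        then show ?thesis ..
      next
        case 4
        have "Polynomial.degree (?B + ?E) < f + 2 * k"
        proof (rule ccontr)
          assume big: "\<not> ?thesis"
          then have "Polynomial.degree (?A + (?B + ?E)) = Polynomial.degree (?B + ?E)"
            using degs 4 fd d0 by (intro degree_add_eq_right) auto
          then show False using small big 4 by (simp only: add.assoc)
        qed
        \<comment> \<open>By \<open>S = F * G\<close> both terms share the factor
          \<open>F * q\<close>; the reflection of \<open>q\<close> exchanges \<open>q\<close> and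
          \<open>2 * G * r - q\<close>.\<close>
        moreover have "?B + ?E = F * q * (2 * G * r - q)"
          by (simp add: power2_eq_square algebra_simps assms(1))
        moreover have "Polynomial.degree (F * q) = f + k"
          using 3 F0 by (simp add: degree_mult_eq k_def f_def)
        ultimately have "Polynomial.degree (F * q * (2 * G * r - q)) < Polynomial.degree (F * q) + k"
          by (simp only: mult_2 add.assoc)
        then have "2 * G * r - q = 0 \<or> Polynomial.degree (2 * G * r - q) < k"
          by (rule degree_mult_less_cancel[rotated]) (use 3 F0 in simp)
        then have "sz (2 * G * r - q) < sz q"
          unfolding k_def by (rule sz_less) (rule 3)
        then have meas: "sz r + sz (2 * G * r - q) < sz r + sz q" by simp
        obtain x y where "x * q + y * r = 1" using less.prems(1) unfolding bezout_def by blast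
        then have "(- x) * (2 * G * r - q) + (y + 2 * G * x) * r = 1"
          by (simp add: algebra_simps)
        then have bz: "bezout (2 * G * r - q) r" unfolding bezout_def by blast
        have "r ^ 2 + 2 * S * (2 * G * r - q) * r - F * (2 * G * r - q) ^ 2 = ?N"
          by (simp add: power2_eq_square algebra_simps assms(1))
        then show ?thesis using less.hyps[OF meas bz] less.prems(2) by (simp only:)
      next
        case 5
        have "Polynomial.degree (?B + (?A + ?E)) = Polynomial.degree ?B"
          by (rule degree_add_eq_left, rule le_less_trans[OF degree_add_le_max]) (use degs 5 fd d0 in auto)
        then have "Polynomial.degree (?A + ?B + ?E) = d + k + a"
          by (simp only: add.assoc add.left_commute[of ?A] degs)
        then have False using small 5 by linarith
        then show ?thesis ..
      qed
    qed
  qed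
qed

text \<open>The substitution \<open>p = r + S * q\<close> turns the norm form of
  \<open>S ^ 2 + F\<close> into the form of the descent and preserves coprimality.\<close>

lemma small_norm_dvd:
  fixes S F p q :: "'a::field poly"
  assumes "F dvd S" "S \<noteq> 0" "(2::'a) \<noteq> 0" "bezout p q"
    and "Polynomial.degree (p ^ 2 - (S ^ 2 + F) * q ^ 2) < Polynomial.degree S"
  shows "(p ^ 2 - (S ^ 2 + F) * q ^ 2) dvd F"
proof -
  obtain G where G: "S = F * G" using assms(1) by (rule dvdE)
  obtain a b where "a * p + b * q = 1" using assms(4) unfolding bezout_def by blast
  then have "(b + a * S) * q + a * (p - S * q) = 1" by (simp add: algebra_simps)
  then have bz: "bezout q (p - S * q)" unfolding bezout_def by blast
  have "(p - S * q) ^ 2 + 2 * S * q * (p - S * q) - F * q ^ 2 = p ^ 2 - (S ^ 2 + F) * q ^ 2"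
    by (simp add: power2_eq_square algebra_simps)
  then show ?thesis using small_form_value_dvd[OF G assms(2,3) bz] assms(5) by simp
qed

section \<open>Fractions in lowest terms and complete integral closedness\<close>

lemma fract_eq_ratio:
  fixes w :: "'a::{euclidean_ring} fract"
  obtains p q where "q \<noteq> 0" "bezout p q" "w = to_fract p / to_fract q"
proof -
  obtain a b where ab: "w = Fraction_Field.Fract a b" "b \<noteq> 0" by (cases w) auto
  obtain g p q where g: "a = g * p" "b = g * q" "bezout p q" using bezout_decomposition by blast
  then have "w = to_fract p / to_fract q" using ab
    by (simp add: Fract_conv_to_fract)
  moreover have "q \<noteq> 0" using g(2) ab(2) by auto
  ultimately show ?thesis using that g(3) by blast
qed

text \<open>In lowest terms \<open>w = p / q\<close>, every power of \<open>q\<close> divides the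
  fixed \<open>c\<close>; the exponent \<open>degree c + 1\<close> then forces \<open>q\<close> to
  be constant.\<close>

lemma fract_integral_if_powers_bounded:
  fixes w :: "'a::field poly fract" and c :: "'a poly"
  assumes "c \<noteq> 0" "\<And>i::nat. \<exists>h. to_fract c * w ^ i = to_fract h"
  obtains h where "w = to_fract h"
proof -
  obtain p q where pq: "q \<noteq> 0" "bezout p q" "w = to_fract p / to_fract q" using fract_eq_ratio .
  have to_fract_power: "to_fract (x ^ i) = to_fract x ^ i" for x :: "'a poly" and i
    by (induction i) auto
  have dv: "q ^ i dvd c" for i
  proof -
    obtain h where "to_fract c * w ^ i = to_fract h" using assms(2) by blast
    then have "to_fract (c * p ^ i) = to_fract (h * q ^ i)" using pq(1,3)
      by (simp add: field_simps to_fract_power)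
    then have "c * p ^ i = h * q ^ i" by (simp only: to_fract_eq_iff)
    then have "q ^ i dvd p ^ i * c" by (metis dvd_triv_right mult.commute)
    moreover have "bezout (q ^ i) (p ^ i)"
      by (rule bezout_powers[OF pq(2)])
    ultimately show ?thesis using bezout_dvd_mult by blast
  qed
  have "Polynomial.degree q = 0"
  proof (rule ccontr)
    assume "Polynomial.degree q \<noteq> 0"
    have "Polynomial.degree (q ^ Suc (Polynomial.degree c)) \<le> Polynomial.degree c"
      by (rule dvd_imp_degree_le) (use dv assms in blast)+
    then have "Suc (Polynomial.degree c) * Polynomial.degree q \<le> Polynomial.degree c"
      by (simp only: degree_power_eq[OF pq(1)])
    moreover have "Suc (Polynomial.degree c) * 1 \<le> Suc (Polynomial.degree c) * Polynomial.degree q"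
      using \<open>Polynomial.degree q \<noteq> 0\<close> by (intro mult_le_mono) auto
    ultimately show False by (metis Suc_n_not_le_n le_trans mult.right_neutral)
  qed
  then obtain u where u: "q = [:u:]" "u \<noteq> 0" using pq(1) by (metis degree_eq_zeroE pCons_0_0)
  have "p = q * ([:inverse u:] * p)" using u by simp
  then have "to_fract p = to_fract q * to_fract ([:inverse u:] * p)"
    by (metis to_fract_mult)
  then have "w = to_fract ([:inverse u:] * p)" using pq by simp
  then show ?thesis using that by blast
qed

section \<open>The ring of integers\<close>

lemma to_fract_power: "to_fract (x ^ i) = to_fract x ^ i"
  by (induction i) auto

lemma of_R_simps [simp]:
  "of_R 0 = 0" "of_R 1 = 1" "of_R (p + q) = of_R p + of_R q" "of_R (p - q) = of_R p - of_R q"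
  "of_R (- p) = - of_R p" "of_R (p * q) = of_R p * of_R q"
  by (simp_all add: of_R_def)

lemma of_R_power [simp]: "of_R (p ^ i) = of_R p ^ i"
  by (simp add: of_R_def to_fract_power)

lemma of_R_eq_0_iff [simp]: "of_R p = 0 \<longleftrightarrow> p = 0"
  by (simp add: of_R_def)

lemma sqrt_R_square: "sqrt_R D * sqrt_R D = of_R D"
proof -
  have "\<exists>s. s ^ 2 = of_R D" using nth_root_exists[of 2 "of_R D"] by auto
  then show ?thesis unfolding sqrt_R_def by (metis (mono_tags, lifting) someI_ex power2_eq_square)
qed

text \<open>Coordinates over k with respect to 1 and \<open>sqrt_R D\<close>; the conjugate of
  \<open>quad D u v\<close> is written as \<open>quad D u (- v)\<close>.\<close>

definition quad :: "'a::field poly \<Rightarrow> 'a poly fract \<Rightarrow> 'a poly fract \<Rightarrow> 'a poly fract alg_closure" where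
  "quad D u v = to_ac u + to_ac v * sqrt_R D"

abbreviation quad_R :: "'a::field poly \<Rightarrow> 'a poly \<Rightarrow> 'a poly \<Rightarrow> 'a poly fract alg_closure" where
  "quad_R D p q \<equiv> quad D (to_fract p) (to_fract q)"

lemma quad_add: "quad D u v + quad D u' v' = quad D (u + u') (v + v')"
  by (simp add: quad_def algebra_simps)

lemma quad_uminus: "- quad D u v = quad D (- u) (- v)"
  by (simp add: quad_def algebra_simps)

lemma quad_mult:
  "quad D u v * quad D u' v' = quad D (u * u' + to_fract D * v * v') (u * v' + v * u')"
proof -
  have "quad D u v * quad D u' v' = to_ac u * to_ac u' + to_ac v * to_ac v' * (sqrt_R D * sqrt_R D)
     + (to_ac u * to_ac v' + to_ac v * to_ac u') * sqrt_R D"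
    by (simp add: quad_def algebra_simps)
  then show ?thesis by (simp add: quad_def sqrt_R_square of_R_def algebra_simps)
qed

lemma quad_R_eq: "quad_R D p q = of_R p + of_R q * sqrt_R D"
  by (simp add: quad_def of_R_def)

lemma quad_norm: "quad D u v * quad D u (- v) = to_ac (u ^ 2 - to_fract D * v ^ 2)"
  by (simp add: quad_mult power2_eq_square mult.commute) (simp add: quad_def mult_ac)

lemma a_inv_ring_of_type_algebra:
  "\<ominus>\<^bsub>ring_of_type_algebra\<^esub> (x :: 'b::Fields.field) = - x"
proof -
  interpret R: field "ring_of_type_algebra :: 'b ring" by rule
  show ?thesis by (rule R.minus_equality) (auto simp: ring_of_type_algebra_def)
qed

lemma m_inv_ring_of_type_algebra:
  "x \<noteq> 0 \<Longrightarrow> inv\<^bsub>ring_of_type_algebra\<^esub> (x :: 'b::Fields.field) = inverse x"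
proof -
  interpret R: field "ring_of_type_algebra :: 'b ring" by rule
  assume "x \<noteq> 0"
  then show ?thesis by (intro R.comm_inv_char) (auto simp: ring_of_type_algebra_def)
qed

lemma to_ac_eq_quad: "to_ac u = quad D u 0"
  by (simp add: quad_def)

locale quadratic =
  fixes D :: "'a::field poly"
  assumes deg_pos: "Polynomial.degree D > 0" and sqfree: "squarefree D" and two: "(2::'a) \<noteq> 0"
begin

text \<open>In lowest terms, \<open>D * q ^ 2 = p ^ 2\<close> makes \<open>q\<close> a unit; then
  \<open>p ^ 2\<close> divides the square-free \<open>D\<close>, so \<open>p\<close> and finally
  \<open>D\<close> are units, against the positive degree.\<close>

lemma nonsquare: "to_fract D \<noteq> w ^ 2"
proof
  assume D: "to_fract D = w ^ 2"
  obtain p q where pq: "q \<noteq> 0" "bezout p q" "w = to_fract p / to_fract q" using fract_eq_ratio .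
  then have "w * to_fract q = to_fract p" by simp
  then have "to_fract (D * q ^ 2) = to_fract (p ^ 2)" using D
    by (simp add: to_fract_power flip: power_mult_distrib)
  then have eq: "D * q ^ 2 = p ^ 2" by (simp only: to_fract_eq_iff)
  then have "q ^ 2 dvd p ^ 2" by (metis dvd_triv_right)
  moreover have "bezout (q ^ 2) (p ^ 2)"
    by (rule bezout_powers[OF pq(2)])
  ultimately have "q ^ 2 dvd 1" by (rule bezout_self_dvd[rotated])
  then obtain k where k: "1 = q ^ 2 * k" by (auto simp: dvd_def)
  then have "D = p ^ 2 * k" using eq by (metis mult.assoc mult.right_neutral)
  then have "p dvd 1" using sqfree unfolding squarefree_def by auto
  then have "p ^ 2 dvd 1" by (metis dvd_power_same power_one)
  moreover have "k dvd 1" using k by (metis dvd_triv_right)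
  ultimately have "D dvd 1" using \<open>D = p ^ 2 * k\<close> by (metis mult_dvd_mono mult_1)
  then show False using deg_pos is_unit_iff_degree[of D] by (cases "D = 0") auto
qed

text \<open>A nontrivial relation would put \<open>sqrt_R D\<close> into k and make \<open>D\<close>
  a square there.\<close>

lemma quad_eq_0_iff: "quad D u v = 0 \<longleftrightarrow> u = 0 \<and> v = 0"
proof
  assume z: "quad D u v = 0"
  have "v = 0"
  proof (rule ccontr)
    assume v: "v \<noteq> 0"
    have "to_ac v * sqrt_R D = - to_ac u" using z by (simp add: quad_def eq_neg_iff_add_eq_0 add.commute)
    then have "sqrt_R D = to_ac (- u / v)" using v by (simp add: field_simps)
    then have "of_R D = to_ac ((- u / v) ^ 2)" by (metis sqrt_R_square power2_eq_square to_ac_power)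
    then have "to_fract D = (- u / v) ^ 2" unfolding of_R_def by (simp only: to_ac_eq_iff)
    then show False using nonsquare by blast
  qed
  then show "u = 0 \<and> v = 0" using z by (simp add: quad_def)
qed (simp add: quad_def)

lemma quad_eq_iff: "quad D u v = quad D u' v' \<longleftrightarrow> u = u' \<and> v = v'"
proof -
  have "quad D u v = quad D u' v' \<longleftrightarrow> quad D (u - u') (v - v') = 0"
    using quad_add[of D "u - u'" "v - v'" u' v'] by (metis add_cancel_left_left diff_add_cancel)
  then show ?thesis by (simp add: quad_eq_0_iff)
qed

text \<open>Rationalisation by the conjugate, the norm lying in k. For the zero element the
  convention \<open>inverse 0 = 0\<close> applies.\<close>

lemma inverse_quad: "\<exists>u' v'. inverse (quad D u v) = quad D u' v'"
proof (cases "quad D u v = 0")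
  case True
  then show ?thesis by (metis inverse_zero)
next
  case False
  define N where "N = u ^ 2 - to_fract D * v ^ 2"
  have "quad D u (- v) \<noteq> 0" using False by (simp add: quad_eq_0_iff)
  then have N: "quad D u v * quad D u (- v) = to_ac N" "N \<noteq> 0"
    using quad_norm[of D u v] False unfolding N_def by (metis, metis mult_eq_0_iff to_ac_0)
  then have "quad D u v * (quad D u (- v) * to_ac (inverse N)) = 1"
    by (simp flip: mult.assoc)
  then have "inverse (quad D u v) = quad D u (- v) * quad D (inverse N) 0"
    by (metis inverse_unique to_ac_eq_quad)
  then show ?thesis by (metis quad_mult)
qed

text \<open>The k-span of 1 and \<open>sqrt_R D\<close> contains the generators and is already
  closed under the field operations, inverses included.\<close>

lemma quad_field_eq: "quad_field D = {quad D u v | u v. True}"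
proof
  have sub: "x \<in> quad_field D \<Longrightarrow> \<exists>u v. x = quad D u v" for x
    unfolding quad_field_def
  proof (induction rule: generate_field.induct)
    case one
    have "\<one>\<^bsub>ring_of_type_algebra\<^esub> = quad D 1 0" by (simp add: quad_def ring_of_type_algebra_def)
    then show ?case by blast
  next
    case (incl h)
    have "sqrt_R D = quad D 0 1" by (simp add: quad_def)
    then show ?case using incl to_ac_eq_quad by blast
  next
    case (a_inv h)
    then show ?case by (metis a_inv_ring_of_type_algebra quad_uminus)
  next
    case (m_inv h)
    then have "inv\<^bsub>ring_of_type_algebra\<^esub> h = inverse h"
      by (intro m_inv_ring_of_type_algebra) (simp add: ring_of_type_algebra_def)
    then show ?case using m_inv inverse_quad by metis
  next
    case (eng_add h1 h2)
    then obtain u v u' v' where "h1 = quad D u v" "h2 = quad D u' v'" by blast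
    then have "h1 \<oplus>\<^bsub>ring_of_type_algebra\<^esub> h2 = quad D (u + u') (v + v')"
      by (simp add: ring_of_type_algebra_def quad_add)
    then show ?case by blast
  next
    case (eng_mult h1 h2)
    then obtain u v u' v' where "h1 = quad D u v" "h2 = quad D u' v'" by blast
    then have "h1 \<otimes>\<^bsub>ring_of_type_algebra\<^esub> h2 = quad D (u * u' + to_fract D * v * v') (u * v' + v * u')"
      by (simp add: ring_of_type_algebra_def quad_mult)
    then show ?case by blast
  qed
  then show "quad_field D \<subseteq> {quad D u v | u v. True}" by blast
  have in1: "sqrt_R D \<in> quad_field D" "to_ac u \<in> quad_field D" for u
    unfolding quad_field_def by (auto intro: generate_field.incl)
  have "to_ac u + to_ac v * sqrt_R D \<in> quad_field D" for u v
    using generate_field.eng_add[OF in1(2)[unfolded quad_field_def]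
       generate_field.eng_mult[OF in1(2)[unfolded quad_field_def] in1(1)[unfolded quad_field_def]]]
    by (simp add: ring_of_type_algebra_def quad_field_def)
  then show "{quad D u v | u v. True} \<subseteq> quad_field D" by (auto simp: quad_def)
qed

text \<open>The order R[sqrt D]. It turns out to be the whole integral closure, because
  \<open>D\<close> is square-free and 2 is invertible.\<close>

definition O_R :: "'a poly fract alg_closure set" where
  "O_R = {quad_R D p q | p q. True}"

lemma quad_R_add: "quad_R D p q + quad_R D p' q' = quad_R D (p + p') (q + q')"
  by (simp add: quad_add)

lemma O_R_add: "x \<in> O_R \<Longrightarrow> y \<in> O_R \<Longrightarrow> x + y \<in> O_R"
  unfolding O_R_def using quad_R_add by blast

lemma quad_R_mult: "quad_R D p q * quad_R D p' q' = quad_R D (p * p' + D * q * q') (p * q' + q * p')"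
  by (simp add: quad_mult)

lemma O_R_mult: "x \<in> O_R \<Longrightarrow> y \<in> O_R \<Longrightarrow> x * y \<in> O_R"
  unfolding O_R_def using quad_R_mult by blast

lemma of_R_in_O_R: "of_R p \<in> O_R"
  unfolding O_R_def by (intro CollectI exI[of _ p] exI[of _ 0]) (simp add: quad_def of_R_def)

lemma O_R_0_1: "0 \<in> O_R" "1 \<in> O_R"
  using of_R_in_O_R[of 0] of_R_in_O_R[of 1] by simp_all

lemma O_R_power: "x \<in> O_R \<Longrightarrow> x ^ i \<in> O_R"
  by (induction i) (auto intro: O_R_0_1 O_R_mult)

lemma O_R_sum: "(\<And>i. i \<in> A \<Longrightarrow> f i \<in> O_R) \<Longrightarrow> sum f A \<in> O_R"
  by (induction A rule: infinite_finite_induct) (auto intro: O_R_0_1 O_R_add)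

lemma of_nat_in_O_R: "of_nat m \<in> O_R"
  by (induction m) (auto intro: O_R_0_1 O_R_add)

text \<open>Conjugation respects powers. This carries a common denominator for the powers of an
  element over to its conjugate.\<close>

lemma quad_power_conj: "\<exists>a b. quad D u v ^ i = quad D a b \<and> quad D u (- v) ^ i = quad D a (- b)"
proof (induction i)
  case 0
  have "quad D 1 0 = 1" by (simp add: quad_def)
  then show ?case by (intro exI[of _ 1] exI[of _ 0]) simp
next
  case (Suc i)
  then obtain a b where "quad D u v ^ i = quad D a b" "quad D u (- v) ^ i = quad D a (- b)" by blast
  then show ?case
    by (intro exI[of _ "u * a + to_fract D * v * b"] exI[of _ "u * b + v * a"])
      (simp add: quad_mult algebra_simps)
qed

text \<open>The ring \<open>F\<^sub>q[T]\<close> is completely integrally closed, so it suffices to work with a common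
  denominator of all powers of an integral element.\<close>

lemma integral_powers_bounded:
  assumes "integral_over_R z" "z = quad D u v"
  obtains c where "c \<noteq> 0" "\<And>i::nat. of_R c * z ^ i \<in> O_R"
proof -
  obtain p where p: "Polynomial.lead_coeff p = 1" "poly (map_poly of_R p) z = 0"
    using assms(1) unfolding integral_over_R_def by blast
  define m where "m = Polynomial.degree p"
  have "poly (map_poly of_R p) z = (\<Sum>j\<le>Polynomial.degree (map_poly of_R p). of_R (Polynomial.coeff p j) * z ^ j)"
    by (simp add: poly_altdef coeff_map_poly)
  also have "Polynomial.degree (map_poly of_R p) = m"
    unfolding m_def by (rule degree_map_poly) simp
  also have "(\<Sum>j\<le>m. of_R (Polynomial.coeff p j) * z ^ j)
      = (\<Sum>j<m. of_R (Polynomial.coeff p j) * z ^ j) + z ^ m"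
    using p(1) by (simp add: m_def lessThan_Suc_atMost[symmetric])
  finally have zm: "z ^ m = (\<Sum>j<m. of_R (- Polynomial.coeff p j) * z ^ j)"
    using p(2) by (simp add: sum_negf eq_neg_iff_add_eq_0 add.commute)
  obtain a t where at: "t \<noteq> 0" "u = to_fract a / to_fract t" by (rule fract_eq_ratio[of u])
  obtain b t' where bt: "t' \<noteq> 0" "v = to_fract b / to_fract t'" by (rule fract_eq_ratio[of v])
  define c where "c = t * t'"
  have c0: "c \<noteq> 0" using at bt by (simp add: c_def)
  have "of_R c * z = quad D (to_fract c * u) (to_fract c * v)"
    by (simp add: assms(2) quad_def of_R_def algebra_simps)
  also have "\<dots> = quad_R D (t' * a) (t * b)" using at bt by (simp add: c_def)
  finally have cz: "of_R c * z \<in> O_R" unfolding O_R_def by blast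
  \<comment> \<open>Up to exponent \<open>m\<close> the factor \<open>c ^ m\<close> clears the
    denominators directly; beyond it, the monic relation \<open>zm\<close> lowers the
    exponent.\<close>
  have "of_R (c ^ m) * z ^ i \<in> O_R" for i
  proof (induction i rule: less_induct)
    case (less i)
    show ?case
    proof (cases "i \<le> m")
      case True
      then have "of_R (c ^ m) * z ^ i = of_R (c ^ (m - i)) * (of_R c * z) ^ i"
        by (simp add: power_mult_distrib flip: power_add mult.assoc)
      then show ?thesis using of_R_in_O_R O_R_mult O_R_power cz by metis
    next
      case False
      then have "z ^ i = z ^ (i - m) * z ^ m" by (simp flip: power_add)
      also have "\<dots> = (\<Sum>j<m. of_R (- Polynomial.coeff p j) * z ^ (i - m + j))"
        by (subst zm) (simp add: sum_distrib_left power_add mult_ac)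
      finally have "of_R (c ^ m) * z ^ i
          = (\<Sum>j<m. of_R (- Polynomial.coeff p j) * (of_R (c ^ m) * z ^ (i - m + j)))"
        by (simp add: sum_distrib_left mult_ac)
      also have "\<dots> \<in> O_R"
        by (intro O_R_sum O_R_mult[OF of_R_in_O_R] less) (use False in auto)
      finally show ?thesis .
    qed
  qed
  then show ?thesis using that[of "c ^ m"] c0 by simp
qed

lemma O_R_conj: "quad D a b \<in> O_R \<longleftrightarrow> quad D a (- b) \<in> O_R"
proof -
  have "quad D a b \<in> O_R \<Longrightarrow> quad D a (- b) \<in> O_R" for a b
    unfolding O_R_def by (auto simp: quad_eq_iff) (metis to_fract_uminus)
  from this[of a b] this[of a "- b"] show ?thesis by auto
qed

lemma to_ac_in_O_R: "to_ac w \<in> O_R \<longleftrightarrow> (\<exists>h. w = to_fract h)"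
  unfolding O_R_def by (auto simp: to_ac_eq_quad[of w D] quad_eq_iff intro: exI[of _ 0])

text \<open>All powers of the trace \<open>2 * u\<close> have a common denominator, and so do those
  of the norm, hence both are polynomials. Division by 2 gives \<open>u\<close>, and square-freeness
  of \<open>D\<close> removes the denominator of \<open>v\<close>.\<close>

lemma integral_in_O_R:
  assumes "integral_over_R (quad D u v)"
  shows "quad D u v \<in> O_R"
proof -
  define z z' where "z = quad D u v" and "z' = quad D u (- v)"
  obtain c where c: "c \<noteq> 0" "\<And>i::nat. of_R c * z ^ i \<in> O_R"
    using integral_powers_bounded[OF assms refl] unfolding z_def by blast
  have c': "of_R c * z' ^ i \<in> O_R" for i
  proof -
    obtain a b where ab: "z ^ i = quad D a b" "z' ^ i = quad D a (- b)"
      using quad_power_conj unfolding z_def z'_def by blast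
    have "of_R c * quad D a' b' = quad D (to_fract c * a') (to_fract c * b')" for a' b'
      by (simp add: quad_def of_R_def algebra_simps)
    then show ?thesis using c(2)[of i] ab O_R_conj by simp
  qed
  \<comment> \<open>One \<open>c\<close> serves the power of \<open>z\<close> and one the power of
    its conjugate, so \<open>c ^ 2\<close> is a denominator uniform in both exponents and hence for
    all powers of their sum and product.\<close>
  have cc: "of_R (c ^ 2) * (z ^ i * z' ^ j) \<in> O_R" for i j
    using O_R_mult[OF c(2)[of i] c'[of j]] by (simp add: power2_eq_square mult_ac)
  have "\<exists>h. to_fract (c ^ 2) * (2 * u) ^ i = to_fract h" for i
  proof -
    have "z + z' = to_ac (2 * u)" by (simp add: z_def z'_def quad_def)
    then have "to_ac (to_fract (c ^ 2) * (2 * u) ^ i) = of_R (c ^ 2) * (z + z') ^ i"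
      by (simp add: of_R_def)
    also have "\<dots> = (\<Sum>k\<le>i. of_nat (i choose k) * (of_R (c ^ 2) * (z ^ k * z' ^ (i - k))))"
      by (simp add: binomial_ring sum_distrib_left mult_ac)
    also have "\<dots> \<in> O_R" by (intro O_R_sum O_R_mult of_nat_in_O_R cc)
    finally show ?thesis unfolding to_ac_in_O_R .
  qed
  then obtain h where h: "2 * u = to_fract h"
    using fract_integral_if_powers_bounded[of "c ^ 2" "2 * u"] c(1) by auto
  have "\<exists>h. to_fract (c ^ 2) * (u ^ 2 - to_fract D * v ^ 2) ^ i = to_fract h" for i
  proof -
    have "z * z' = to_ac (u ^ 2 - to_fract D * v ^ 2)" unfolding z_def z'_def by (rule quad_norm)
    then have "to_ac (to_fract (c ^ 2) * (u ^ 2 - to_fract D * v ^ 2) ^ i) = of_R (c ^ 2) * (z ^ i * z' ^ i)"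
      by (simp add: of_R_def flip: power_mult_distrib)
    then show ?thesis using cc to_ac_in_O_R by metis
  qed
  then obtain g where g: "u ^ 2 - to_fract D * v ^ 2 = to_fract g"
    using fract_integral_if_powers_bounded[of "c ^ 2" "u ^ 2 - to_fract D * v ^ 2"] c(1) by auto
  obtain k :: "'a poly" where "2 * k = 1" using two two_invertible_poly by blast
  define h' where "h' = k * h"
  have "2 * h' = h" unfolding h'_def using \<open>2 * k = 1\<close> by (simp flip: mult.assoc)
  moreover have "to_fract (2 :: 'a poly) = 2" by (metis one_add_one to_fract_1 to_fract_add)
  ultimately have "to_fract 2 * u = to_fract 2 * to_fract h'" using h by (metis to_fract_mult)
  moreover have "(2 :: 'a poly) \<noteq> 0" using two by (simp add: numeral_poly)
  ultimately have u: "u = to_fract h'" by simp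
  obtain p q where pq: "q \<noteq> 0" "bezout p q" "v = to_fract p / to_fract q" using fract_eq_ratio .
  have "to_fract D * v ^ 2 = to_fract (h' ^ 2 - g)" using g u by (simp add: to_fract_power algebra_simps)
  then have "to_fract (D * p ^ 2) = to_fract ((h' ^ 2 - g) * q ^ 2)"
    using pq by (simp add: to_fract_power field_simps)
  then have "D * p ^ 2 = (h' ^ 2 - g) * q ^ 2" by (simp only: to_fract_eq_iff)
  \<comment> \<open>Being coprime to \<open>p ^ 2\<close>, the square \<open>q ^ 2\<close> must
    divide \<open>D\<close>, so square-freeness makes \<open>q\<close> a unit.\<close>
  then have "q ^ 2 dvd p ^ 2 * D" by (metis dvd_triv_right mult.commute)
  moreover have "bezout (q ^ 2) (p ^ 2)"
    by (rule bezout_powers[OF pq(2)])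
  ultimately have "q dvd 1" using bezout_dvd_mult sqfree unfolding squarefree_def by blast
  then obtain k where "1 = q * k" by (auto simp: dvd_def)
  then have "to_fract q * to_fract k = 1" by (metis to_fract_1 to_fract_mult)
  moreover have "v * to_fract q = to_fract p" using pq by simp
  moreover have "v = v * to_fract q * to_fract k" using calculation(1) by (simp add: mult.assoc)
  ultimately have "v = to_fract (p * k)" by simp
  then show ?thesis using u unfolding O_R_def by blast
qed

lemma quad_R_integral: "integral_over_R (quad_R D p q)"
proof -
  \<comment> \<open>The monic polynomial with the trace and norm of the element as coefficients; its
    roots are the element and its conjugate.\<close>
  define P where "P = [:p ^ 2 - D * q ^ 2, - 2 * p, 1:]"
  have "map_poly of_R P = [:of_R (p ^ 2 - D * q ^ 2), of_R (- 2 * p), 1:]"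
    unfolding P_def by (simp add: map_poly_pCons)
  then have "poly (map_poly of_R P) (quad_R D p q) = of_R (p ^ 2 - D * q ^ 2)
     + quad_R D p q * (of_R (- 2 * p) + quad_R D p q)" by simp
  also have "of_R (- 2 * p) = - of_R p - of_R p"
    by (metis mult_2 mult_minus_left of_R_simps(3,5) minus_add_distrib diff_conv_add_uminus)
  also have "of_R (p ^ 2 - D * q ^ 2) + quad_R D p q * (- of_R p - of_R p + quad_R D p q)
     = of_R q * of_R q * (sqrt_R D * sqrt_R D) - of_R D * of_R q * of_R q"
    by (simp add: quad_R_eq algebra_simps power2_eq_square)
  also have "\<dots> = 0" by (simp add: sqrt_R_square)
  finally show ?thesis unfolding integral_over_R_def
    by (intro exI[of _ P]) (simp add: P_def)
qed

lemma int_ring_eq: "int_ring D = O_R"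
proof
  show "int_ring D \<subseteq> O_R" unfolding int_ring_def quad_field_eq using integral_in_O_R by blast
  show "O_R \<subseteq> int_ring D" unfolding int_ring_def quad_field_eq O_R_def using quad_R_integral by blast
qed

end

section \<open>Ideal classes\<close>

lemma ideal_mult_0: "0 \<in> ideal_mult I J"
  unfolding ideal_mult_def by (intro CollectI exI[of _ "0::nat"]) simp

lemma ideal_mult_add_prod:
  assumes "x \<in> ideal_mult I J" "a \<in> I" "b \<in> J"
  shows "x + a * b \<in> ideal_mult I J"
proof -
  obtain m :: nat and f g where fg: "x = (\<Sum>i<m. f i * g i)" "\<forall>i<m. f i \<in> I" "\<forall>i<m. g i \<in> J"
    using assms(1) unfolding ideal_mult_def by blast
  have "x + a * b = (\<Sum>i<Suc m. (f(m := a)) i * (g(m := b)) i)"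
    using fg(1) by simp
  moreover have "\<forall>i<Suc m. (f(m := a)) i \<in> I" "\<forall>i<Suc m. (g(m := b)) i \<in> J"
    using fg assms(2,3) by auto
  ultimately show ?thesis unfolding ideal_mult_def by blast
qed

lemma ideal_mult_prod: "a \<in> I \<Longrightarrow> b \<in> J \<Longrightarrow> a * b \<in> ideal_mult I J"
  using ideal_mult_add_prod[OF ideal_mult_0] by fastforce

lemma ideal_mult_add:
  assumes "x \<in> ideal_mult I J" "y \<in> ideal_mult I J"
  shows "x + y \<in> ideal_mult I J"
proof -
  obtain m :: nat and f g where fg: "y = (\<Sum>i<m. f i * g i)" "\<forall>i<m. f i \<in> I" "\<forall>i<m. g i \<in> J"
    using assms(2) unfolding ideal_mult_def by blast
  have "k \<le> m \<Longrightarrow> x + (\<Sum>i<k. f i * g i) \<in> ideal_mult I J" for k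
  proof (induction k)
    case (Suc k)
    then show ?case using ideal_mult_add_prod[of "x + (\<Sum>i<k. f i * g i)" I J "f k" "g k"] fg
      by (simp add: add.assoc)
  qed (use assms in simp)
  then show ?thesis using fg(1) by simp
qed

text \<open>This rule reduces inclusions of a product ideal in an additively closed set to products
  of two elements.\<close>

lemma ideal_mult_least:
  assumes "0 \<in> M" "\<And>x y. x \<in> M \<Longrightarrow> y \<in> M \<Longrightarrow> x + y \<in> M"
    and "\<And>a b. a \<in> I \<Longrightarrow> b \<in> J \<Longrightarrow> a * b \<in> M"
  shows "ideal_mult I J \<subseteq> M"
proof
  fix x assume "x \<in> ideal_mult I J"
  then obtain m :: nat and f g where fg: "x = (\<Sum>i<m. f i * g i)" "\<forall>i<m. f i \<in> I" "\<forall>i<m. g i \<in> J"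
    unfolding ideal_mult_def by blast
  have "k \<le> m \<Longrightarrow> (\<Sum>i<k. f i * g i) \<in> M" for k
    by (induction k) (use assms fg in auto)
  then show "x \<in> M" using fg(1) by simp
qed

lemma ideal_mult_commute: "ideal_mult I J = ideal_mult J I"
proof -
  have "ideal_mult I J \<subseteq> ideal_mult J I" for I J :: "'b::comm_ring_1 set"
    by (intro ideal_mult_least ideal_mult_0 ideal_mult_add)
      (metis ideal_mult_prod mult.commute)+
  then show ?thesis by blast
qed

text \<open>One inclusion suffices: with \<open>I\<close> and \<open>L\<close> exchanged and
  commutativity applied, it gives the other.\<close>

lemma ideal_mult_assoc: "ideal_mult (ideal_mult I J) L = ideal_mult I (ideal_mult J L)"
proof -
  have sub: "ideal_mult (ideal_mult I J) L \<subseteq> ideal_mult I (ideal_mult J L)"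
    for I J L :: "'b::comm_ring_1 set"
  proof (intro ideal_mult_least ideal_mult_0 ideal_mult_add)
    fix a l assume "a \<in> ideal_mult I J" and l: "l \<in> L"
    \<comment> \<open>For fixed \<open>l\<close> the set on the right is closed under addition, so
      it is enough to test products.\<close>
    moreover have "ideal_mult I J \<subseteq> {x. x * l \<in> ideal_mult I (ideal_mult J L)}"
      using l by (intro ideal_mult_least)
        (auto simp: distrib_right mult.assoc intro: ideal_mult_0 ideal_mult_add ideal_mult_prod)
    ultimately show "a * l \<in> ideal_mult I (ideal_mult J L)" by blast
  qed
  show ?thesis
    using sub[of I J L] sub[of L J I] by (metis ideal_mult_commute subset_antisym)
qed

definition scale :: "'b::comm_ring_1 \<Rightarrow> 'b set \<Rightarrow> 'b set" where
  "scale x I = (\<lambda>r. x * r) ` I"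

lemma scale_one [simp]: "scale 1 I = I"
  by (simp add: scale_def)

lemma scale_scale: "scale x (scale y I) = scale (x * y) I"
  by (simp add: scale_def image_image mult.assoc)

lemma ideal_mult_scale: "ideal_mult (scale x I) J = scale x (ideal_mult I J)"
proof
  show "ideal_mult (scale x I) J \<subseteq> scale x (ideal_mult I J)"
  proof (rule ideal_mult_least)
    show "0 \<in> scale x (ideal_mult I J)" unfolding scale_def using ideal_mult_0 by force
    show "a + b \<in> scale x (ideal_mult I J)"
      if "a \<in> scale x (ideal_mult I J)" "b \<in> scale x (ideal_mult I J)" for a b
      using that unfolding scale_def by (auto simp flip: distrib_left intro: ideal_mult_add)
    show "a * b \<in> scale x (ideal_mult I J)" if "a \<in> scale x I" "b \<in> J" for a b
      using that unfolding scale_def by (auto simp: mult.assoc intro: ideal_mult_prod)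
  qed
  have "ideal_mult I J \<subseteq> {r. x * r \<in> ideal_mult (scale x I) J}"
    by (rule ideal_mult_least)
      (auto simp: distrib_left mult.assoc[symmetric] scale_def
        intro: ideal_mult_0 ideal_mult_add ideal_mult_prod)
  then show "scale x (ideal_mult I J) \<subseteq> ideal_mult (scale x I) J"
    by (auto simp: scale_def)
qed

lemma ideal_mult_scale_right: "ideal_mult I (scale x J) = scale x (ideal_mult I J)"
  by (metis ideal_mult_commute ideal_mult_scale)

context quadratic
begin

section \<open>The class group through scaling classes of fractional ideals\<close>

lemma quad_field_mult: "x \<in> quad_field D \<Longrightarrow> y \<in> quad_field D \<Longrightarrow> x * y \<in> quad_field D"
  unfolding quad_field_eq using quad_mult by blast

lemma quad_field_inverse: "x \<in> quad_field D \<Longrightarrow> inverse x \<in> quad_field D"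
  unfolding quad_field_eq using inverse_quad by blast

lemma O_R_subset: "O_R \<subseteq> quad_field D"
  unfolding quad_field_eq O_R_def by blast

lemma one_in_quad_field: "1 \<in> quad_field D"
  using O_R_subset O_R_0_1 by blast

lemma ideal_mult_unit:
  assumes "fractional_ideal D I"
  shows "ideal_mult O_R I = I"
proof
  show "ideal_mult O_R I \<subseteq> I" 
    by (rule ideal_mult_least) (use assms in \<open>auto simp: fractional_ideal_def int_ring_eq\<close>)
  show "I \<subseteq> ideal_mult O_R I"
    using ideal_mult_prod[OF O_R_0_1(2), of _ I] by auto
qed

text \<open>The orbit of \<open>I\<close> under scaling by nonzero elements of the field. For a
  fractional ideal it is the coset modulo principal ideals, so that classes can be handled through
  representatives.\<close>

definition ideal_class :: "'a poly fract alg_closure set \<Rightarrow> 'a poly fract alg_closure set set" where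
  "ideal_class I = {scale x I | x. x \<in> quad_field D \<and> x \<noteq> 0}"

lemma principal_ideals_eq: "principal_ideals D = ideal_class O_R"
  by (simp add: principal_ideals_def ideal_class_def scale_def int_ring_eq)

lemma self_in_ideal_class: "I \<in> ideal_class I"
  unfolding ideal_class_def using one_in_quad_field by (intro CollectI exI[of _ 1]) simp

lemma ideal_class_scale:
  assumes "x \<in> quad_field D" "x \<noteq> 0"
  shows "ideal_class (scale x I) = ideal_class I"
proof
  show "ideal_class (scale x I) \<subseteq> ideal_class I"
    unfolding ideal_class_def using assms quad_field_mult
    by (auto simp: scale_scale)
  show "ideal_class I \<subseteq> ideal_class (scale x I)"
  proof
    fix J assume "J \<in> ideal_class I"
    then obtain y where y: "J = scale y I" "y \<in> quad_field D" "y \<noteq> 0"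
      unfolding ideal_class_def by blast
    have "J = scale (y * inverse x) (scale x I)" using assms y(1) by (simp add: scale_scale mult.assoc)
    moreover have "y * inverse x \<in> quad_field D" "y * inverse x \<noteq> 0"
      using assms y quad_field_mult quad_field_inverse by auto
    ultimately show "J \<in> ideal_class (scale x I)" unfolding ideal_class_def by blast
  qed
qed

text \<open>Multiplication by the principal ideal of \<open>x\<close> is scaling by
  \<open>x\<close>, because \<open>O_R\<close> acts as the unit on fractional ideals.\<close>

lemma coset_eq_ideal_class:
  assumes "fractional_ideal D I"
  shows "principal_ideals D #>\<^bsub>ideal_group D\<^esub> I = ideal_class I"
  unfolding r_coset_def principal_ideals_eq ideal_class_def ideal_group_def
  using ideal_mult_unit[OF assms] by (auto simp: ideal_mult_scale)

lemma carrier_class_group: "carrier (class_group D) = ideal_class ` {I. fractional_ideal D I}"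
  unfolding class_group_def carrier_FactGroup
  by (simp add: ideal_group_def coset_eq_ideal_class[unfolded ideal_group_def] cong: image_cong_simp)

lemma one_class_group: "\<one>\<^bsub>class_group D\<^esub> = ideal_class O_R"
  by (simp add: class_group_def principal_ideals_eq)

lemma mult_class_group:
  "ideal_class I \<otimes>\<^bsub>class_group D\<^esub> ideal_class J = ideal_class (ideal_mult I J)"
proof -
  have "ideal_class I \<otimes>\<^bsub>class_group D\<^esub> ideal_class J
      = {ideal_mult (scale x I) (scale y J) | x y. x \<in> quad_field D \<and> x \<noteq> 0 \<and> y \<in> quad_field D \<and> y \<noteq> 0}"
    unfolding class_group_def mult_FactGroup set_mult_def ideal_group_def ideal_class_def by auto
  also have "\<dots> = {scale (x * y) (ideal_mult I J) | x y. x \<in> quad_field D \<and> x \<noteq> 0 \<and> y \<in> quad_field D \<and> y \<noteq> 0}"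
    by (simp add: ideal_mult_scale ideal_mult_scale_right scale_scale mult.commute)
  also have "\<dots> = ideal_class (ideal_mult I J)"
  proof -
    \<comment> \<open>A single scalar is split as itself times 1; conversely, a product of two
      nonzero scalars is again one.\<close>
    have "\<exists>x' y. scale x L = scale (x' * y) L \<and> x' \<in> quad_field D \<and> x' \<noteq> 0 \<and> y \<in> quad_field D \<and> y \<noteq> 0"
      if "x \<in> quad_field D" "x \<noteq> 0" for x L
      using that one_in_quad_field by (intro exI[of _ x] exI[of _ 1]) simp
    moreover have "\<exists>x'. scale (x * y) L = scale x' L \<and> x' \<in> quad_field D \<and> x' \<noteq> 0"
      if "x \<in> quad_field D" "x \<noteq> 0" "y \<in> quad_field D" "y \<noteq> 0" for x y L
      using that quad_field_mult by (intro exI[of _ "x * y"]) simp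
    ultimately show ?thesis unfolding ideal_class_def by blast
  qed
  finally show ?thesis .
qed

text \<open>Since invertibility of arbitrary fractional ideals is avoided, \<open>m_inv\<close> in the class group has
  to be computed from its definition by \<open>THE\<close>; the relations between the \<open>A i\<close> give uniqueness.\<close>

lemma has_subgroup_of_order_if_minimal_principal_power:
  assumes n: "n > 0" and frac: "\<And>i. i \<le> n \<Longrightarrow> fractional_ideal D (A i)"
    and A0: "A 0 = O_R" and An: "A n = scale \<alpha> O_R" "\<alpha> \<in> quad_field D" "\<alpha> \<noteq> 0"
    and mult: "\<And>i j. i + j \<le> n \<Longrightarrow> ideal_mult (A i) (A j) = A (i + j)"
    and nonprincipal: "\<And>m. 0 < m \<Longrightarrow> m < n \<Longrightarrow> A m \<notin> ideal_class O_R"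
  shows "has_subgroup_of_order (class_group D) n"
proof -
  define C where "C i = ideal_class (A i)" for i
  define H where "H = C ` {..<n}"
  have An_mult: "ideal_mult (A n) J = scale \<alpha> J" if "fractional_ideal D J" for J
    by (simp add: An ideal_mult_scale ideal_mult_unit[OF that])
  have Cn: "C n = C 0" using An by (simp add: C_def A0 ideal_class_scale)
  have C_mult: "C i \<otimes>\<^bsub>class_group D\<^esub> C j \<in> H" if "i < n" "j < n" for i j
  proof (cases "i + j \<le> n")
    case True
    then have "C i \<otimes>\<^bsub>class_group D\<^esub> C j = C (i + j)" by (simp add: C_def mult_class_group mult)
    moreover have "C (i + j) \<in> H" using True Cn n by (cases "i + j = n") (auto simp: H_def)
    ultimately show ?thesis by simp
  next
    case False
    \<comment> \<open>When the exponent exceeds \<open>n\<close>, \<open>A j\<close> is written as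
      \<open>A (n - i)\<close> times \<open>A (i + j - n)\<close>, so that the principal ideal
      \<open>A n\<close> splits off.\<close>
    have "ideal_mult (A i) (A j) = ideal_mult (A i) (ideal_mult (A (n - i)) (A (i + j - n)))"
      using that False by (simp add: mult)
    also have "\<dots> = ideal_mult (A n) (A (i + j - n))"
      using that mult[of i "n - i"] by (simp flip: ideal_mult_assoc)
    also have "\<dots> = scale \<alpha> (A (i + j - n))" using that by (intro An_mult frac) simp
    finally have "C i \<otimes>\<^bsub>class_group D\<^esub> C j = C (i + j - n)"
      by (simp add: C_def mult_class_group ideal_class_scale An)
    then show ?thesis using that by (simp add: H_def)
  qed
  have C_carrier: "C i \<in> carrier (class_group D)" if "i \<le> n" for i
    unfolding carrier_class_group C_def using frac[OF that] by blast
  have C_inv: "inv\<^bsub>class_group D\<^esub> (C i) = C (n - i)" if "i < n" for i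
  proof -
    have prod: "C i \<otimes>\<^bsub>class_group D\<^esub> C (n - i) = \<one>\<^bsub>class_group D\<^esub>"
      using that Cn by (simp add: C_def mult_class_group mult one_class_group A0)
    have prod': "C (n - i) \<otimes>\<^bsub>class_group D\<^esub> C i = \<one>\<^bsub>class_group D\<^esub>"
      using prod by (simp add: C_def mult_class_group ideal_mult_commute)
    show ?thesis unfolding m_inv_def
    proof (rule the_equality)
      show "C (n - i) \<in> carrier (class_group D) \<and> C i \<otimes>\<^bsub>class_group D\<^esub> C (n - i) = \<one>\<^bsub>class_group D\<^esub>
          \<and> C (n - i) \<otimes>\<^bsub>class_group D\<^esub> C i = \<one>\<^bsub>class_group D\<^esub>"
        using prod prod' C_carrier by simp
    next
      fix y assume y: "y \<in> carrier (class_group D) \<and> C i \<otimes>\<^bsub>class_group D\<^esub> y = \<one>\<^bsub>class_group D\<^esub>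
          \<and> y \<otimes>\<^bsub>class_group D\<^esub> C i = \<one>\<^bsub>class_group D\<^esub>"
      then obtain J where J: "y = ideal_class J" "fractional_ideal D J"
        unfolding carrier_class_group by blast
      have "ideal_class (ideal_mult (A i) J) = ideal_class O_R"
        using y J by (simp add: C_def mult_class_group one_class_group)
      then obtain x where x: "ideal_mult (A i) J = scale x O_R" "x \<in> quad_field D" "x \<noteq> 0"
        using self_in_ideal_class[of "ideal_mult (A i) J"] unfolding ideal_class_def[of O_R] by auto
      \<comment> \<open>Multiplying \<open>A i\<close> times \<open>J\<close>, which is principal
        with generator \<open>x\<close>, by \<open>A (n - i)\<close> shows that \<open>J\<close> and
        \<open>A (n - i)\<close> differ by a scalar only.\<close>
      have "scale \<alpha> J = ideal_mult (ideal_mult (A (n - i)) (A i)) J"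
        using that by (simp add: mult An_mult J)
      also have "\<dots> = ideal_mult (A (n - i)) (scale x O_R)"
        by (simp add: ideal_mult_assoc x)
      also have "\<dots> = scale x (A (n - i))"
        by (simp add: ideal_mult_scale_right ideal_mult_commute[of "A (n - i)"] ideal_mult_unit frac)
      finally show "y = C (n - i)"
        using An x ideal_class_scale J unfolding C_def by metis
    qed
  qed
  have "C i \<noteq> C j" if "i < j" "j < n" for i j
  proof
    assume "C i = C j"
    then obtain x where x: "A j = scale x (A i)" "x \<in> quad_field D" "x \<noteq> 0"
      using self_in_ideal_class[of "A j"] unfolding C_def ideal_class_def[of "A i"] by auto
    \<comment> \<open>The factor \<open>A i\<close> is cancelled by means of its complement
      \<open>A (n - i)\<close>: equal classes would make \<open>A (j - i)\<close> principal.\<close>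
    have "scale \<alpha> (A (j - i)) = ideal_mult (A n) (A (j - i))" using that by (simp add: An_mult frac)
    also have "\<dots> = ideal_mult (A (n - i)) (ideal_mult (A i) (A (j - i)))"
      using that mult[of "n - i" i] by (simp flip: ideal_mult_assoc)
    also have "\<dots> = scale x (ideal_mult (A (n - i)) (A i))"
      using that by (simp add: mult x ideal_mult_scale_right)
    also have "\<dots> = scale x (scale \<alpha> O_R)" using that by (simp add: mult An)
    finally have "scale (inverse \<alpha> * \<alpha>) (A (j - i)) = scale (inverse \<alpha> * (x * \<alpha>)) O_R"
      by (simp flip: scale_scale)
    then have "A (j - i) = scale x O_R" using An by (simp add: mult.left_commute)
    then have "A (j - i) \<in> ideal_class O_R" using x unfolding ideal_class_def by blast
    then show False using nonprincipal[of "j - i"] that by simp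
  qed
  then have "inj_on C {..<n}" by (intro inj_onI) (metis lessThan_iff linorder_neqE_nat)
  then have "card H = n" by (simp add: H_def card_image)
  moreover have "subgroup H (class_group D)"
  proof
    show "H \<subseteq> carrier (class_group D)" using C_carrier by (auto simp: H_def)
    show "x \<otimes>\<^bsub>class_group D\<^esub> y \<in> H" if "x \<in> H" "y \<in> H" for x y
      using that C_mult by (auto simp: H_def)
    show "\<one>\<^bsub>class_group D\<^esub> \<in> H" using n by (auto simp: H_def one_class_group C_def A0 intro!: image_eqI[of _ _ 0])
    show "inv\<^bsub>class_group D\<^esub> x \<in> H" if "x \<in> H" for x
    proof -
      obtain i where i: "i < n" "x = C i" using \<open>x \<in> H\<close> by (auto simp: H_def)
      \<comment> \<open>For \<open>i = 0\<close> the inverse is \<open>C n\<close>, whose index lies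
        outside the range defining \<open>H\<close>; it equals \<open>C 0\<close>.\<close>
      show ?thesis using C_inv[OF i(1)] i Cn n by (cases "i = 0") (auto simp: H_def)
    qed
  qed
  moreover have "finite H" by (simp add: H_def)
  ultimately show ?thesis unfolding has_subgroup_of_order_def by blast
qed

end

section \<open>The ideals generated by powers of Z and Y + sqrt D\<close>

context quadratic
begin

lemma quad_R_eq_iff: "quad_R D p q = quad_R D p' q' \<longleftrightarrow> p = p' \<and> q = q'"
  by (simp add: quad_eq_iff)

text \<open>If \<open>g\<close> is a common factor of \<open>Y\<close> and \<open>Z\<close>, then
  \<open>g ^ 2\<close> divides \<open>Y ^ 2\<close> and, as \<open>n \<ge> 2\<close>, also
  \<open>Z ^ n\<close>, hence \<open>D\<close>; so \<open>g\<close> is a unit. The quantity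
  \<open>2 * Y\<close> is the trace of \<open>Y + sqrt D\<close>.\<close>

lemma bezout_trace_if_squarefree:
  assumes "D = Y ^ 2 - E * Z ^ n" "n \<ge> 2"
  shows "bezout (Z ^ i) (2 * Y)"
proof -
  obtain g Y' Z' where g: "Y = g * Y'" "Z = g * Z'" "bezout Y' Z'"
    using bezout_decomposition by blast
  have "g ^ 2 dvd Z ^ n" using assms(2) g(2) by (simp add: power_mult_distrib le_imp_power_dvd)
  moreover have "g ^ 2 dvd Y ^ 2" using g(1) by (simp add: power_mult_distrib)
  ultimately have "g ^ 2 dvd D" unfolding assms(1) by (intro dvd_diff) auto
  then have "g dvd 1" using sqfree unfolding squarefree_def by blast
  then obtain k where k: "1 = g * k" by (rule dvdE)
  obtain a b where ab: "a * Y' + b * Z' = 1" using g(3) unfolding bezout_def by blast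
  have "(k * b) * Z + (k * a) * Y = (g * k) * (a * Y' + b * Z')"
    by (simp add: g algebra_simps)
  then have "(k * b) * Z + (k * a) * Y = 1" by (simp only: ab k[symmetric] mult_1)
  then have "bezout Z Y" unfolding bezout_def by blast
  moreover obtain h where h: "2 * h = (1 :: 'a poly)" using two two_invertible_poly by blast
  have "bezout Z 2"
    unfolding bezout_def using h by (intro exI[of _ 0] exI[of _ h]) (simp add: mult.commute)
  ultimately show ?thesis by (intro bezout_power_left bezout_mult_right)
qed

text \<open>For \<open>i \<le> n\<close> this is the ideal \<open>(Z ^ i, Y + sqrt D)\<close>, seen
  as the kernel of the reduction modulo \<open>Z ^ i\<close> that sends \<open>sqrt D\<close> to
  \<open>- Y\<close>. Membership becomes a single divisibility.\<close>

definition ideal_A :: "'a poly \<Rightarrow> 'a poly \<Rightarrow> nat \<Rightarrow> 'a poly fract alg_closure set" where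
  "ideal_A Y Z i = {quad_R D p q | p q. Z ^ i dvd p - Y * q}"

lemma quad_R_in_ideal_A: "quad_R D p q \<in> ideal_A Y Z i \<longleftrightarrow> Z ^ i dvd p - Y * q"
  unfolding ideal_A_def by (auto simp: quad_R_eq_iff)

text \<open>Stability under \<open>O_R\<close> rests on \<open>D\<close> being congruent to
  \<open>Y ^ 2\<close> modulo \<open>Z ^ i\<close>, which follows from \<open>i \<le> n\<close>. The
  ideal is integral, so 1 serves as denominator.\<close>

lemma fractional_ideal_A:
  assumes D: "D = Y ^ 2 - E * Z ^ n" and "i \<le> n" "Z \<noteq> 0"
  shows "fractional_ideal D (ideal_A Y Z i)"
proof -
  have sub: "ideal_A Y Z i \<subseteq> O_R" unfolding ideal_A_def O_R_def by blast
  have "0 = quad_R D 0 0" by (simp add: quad_def)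
  then have zero: "0 \<in> ideal_A Y Z i" using quad_R_in_ideal_A[of 0 0] by simp
  have "quad_R D (Z ^ i) 0 \<in> ideal_A Y Z i" by (simp add: quad_R_in_ideal_A del: to_fract_0)
  moreover have "quad_R D (Z ^ i) 0 \<noteq> 0" using assms(3) by (simp add: quad_eq_0_iff)
  ultimately have nz: "ideal_A Y Z i \<noteq> {0}" by blast
  have add: "x + y \<in> ideal_A Y Z i" if xy: "x \<in> ideal_A Y Z i" "y \<in> ideal_A Y Z i" for x y
  proof -
    obtain p q p' q' where "x = quad_R D p q" "y = quad_R D p' q'"
      and dv: "Z ^ i dvd p - Y * q" "Z ^ i dvd p' - Y * q'"
      using xy unfolding ideal_A_def by blast
    moreover have "Z ^ i dvd (p + p') - Y * (q + q')"
      using dvd_add[OF dv] by (simp add: algebra_simps)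
    ultimately show ?thesis by (simp only: quad_R_add quad_R_in_ideal_A)
  qed
  have mult: "r * x \<in> ideal_A Y Z i" if rx: "r \<in> O_R" "x \<in> ideal_A Y Z i" for r x
  proof -
    obtain p q a b where eqs: "x = quad_R D p q" "r = quad_R D a b" and dv: "Z ^ i dvd p - Y * q"
      using rx unfolding ideal_A_def O_R_def by blast
    have "Z ^ i dvd (a - b * Y) * (p - Y * q) - (b * E * q) * Z ^ n"
      by (rule dvd_diff[OF dvd_mult[OF dv] dvd_mult[OF le_imp_power_dvd[OF assms(2)]]])
    also have "(a - b * Y) * (p - Y * q) - (b * E * q) * Z ^ n = (a * p + D * b * q) - Y * (a * q + b * p)"
      unfolding D by (simp add: algebra_simps power2_eq_square)
    finally show ?thesis by (simp only: eqs quad_R_mult quad_R_in_ideal_A)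
  qed
  show ?thesis unfolding fractional_ideal_def int_ring_eq
    using sub O_R_subset zero nz add mult O_R_0_1(2) by (auto intro!: bexI[of _ 1])
qed

lemma ideal_A_0: "ideal_A Y Z 0 = O_R"
  unfolding ideal_A_def O_R_def by simp

text \<open>The norm of \<open>Y + sqrt D\<close> is \<open>E * Z ^ n\<close> with \<open>E\<close>
  a unit, so \<open>Z ^ n\<close> is itself a multiple of \<open>Y + sqrt D\<close>.\<close>

lemma ideal_A_principal:
  assumes D: "D = Y ^ 2 - E * Z ^ n" and "E dvd 1"
  shows "ideal_A Y Z n = scale (quad_R D Y 1) O_R"
proof
  obtain E' where E: "1 = E * E'" using assms(2) by (rule dvdE)
  show "scale (quad_R D Y 1) O_R \<subseteq> ideal_A Y Z n"
  proof
    fix x assume "x \<in> scale (quad_R D Y 1) O_R"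
    then obtain a b where "x = quad_R D Y 1 * quad_R D a b" unfolding scale_def O_R_def by blast
    then have "x = quad_R D (Y * a + D * 1 * b) (Y * b + 1 * a)" by (simp only: quad_R_mult)
    moreover have "Z ^ n dvd (Y * a + D * 1 * b) - Y * (Y * b + 1 * a)"
    proof -
      have "(Y * a + D * 1 * b) - Y * (Y * b + 1 * a) = Z ^ n * (- E * b)"
        unfolding D by (simp add: algebra_simps power2_eq_square)
      then show ?thesis by (metis dvd_triv_left)
    qed
    ultimately show "x \<in> ideal_A Y Z n" by (simp only: quad_R_in_ideal_A)
  qed
  show "ideal_A Y Z n \<subseteq> scale (quad_R D Y 1) O_R"
  proof
    fix x assume "x \<in> ideal_A Y Z n"
    then obtain p q where x: "x = quad_R D p q" "Z ^ n dvd p - Y * q" unfolding ideal_A_def by blast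
    obtain k where k: "p - Y * q = Z ^ n * k" using x(2) by (rule dvdE)
    \<comment> \<open>Comparing coordinates in
      \<open>(Y + sqrt D) * (c + b * sqrt D) = p + q * sqrt D\<close> gives
      \<open>c = q - Y * b\<close> and \<open>E * b = - k\<close>.\<close>
    define b where "b = - E' * k"
    have "E * b = - ((E * E') * k)" by (simp add: b_def)
    then have Eb: "E * b = - k" by (simp only: E[symmetric] mult_1)
    have "Y * (q - Y * b) + D * 1 * b = Y * q - Z ^ n * (E * b)"
      unfolding D by (simp add: algebra_simps power2_eq_square)
    also have "\<dots> = p" using k Eb by (simp add: algebra_simps)
    finally have "quad_R D Y 1 * quad_R D (q - Y * b) b = x"
      unfolding quad_R_mult x by (simp add: quad_R_eq_iff)
    then show "x \<in> scale (quad_R D Y 1) O_R" unfolding scale_def O_R_def by blast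
  qed
qed

text \<open>The product contains \<open>Z ^ i * (Y + sqrt D)\<close> and
  \<open>(Y + sqrt D) ^ 2 = 2 * Y * (Y + sqrt D) - E * Z ^ n\<close>. As \<open>Z ^ i\<close> and
  \<open>2 * Y\<close> are comaximal, these recover \<open>Y + sqrt D\<close> up to a multiple of
  \<open>Z ^ n\<close>.\<close>

lemma ideal_A_mult:
  assumes D: "D = Y ^ 2 - E * Z ^ n" and "i + j \<le> n" "Z \<noteq> 0"
  shows "ideal_mult (ideal_A Y Z i) (ideal_A Y Z j) = ideal_A Y Z (i + j)"
proof (cases "i = 0 \<or> j = 0")
  case True
  have "ideal_mult O_R (ideal_A Y Z k) = ideal_A Y Z k" if "k \<le> n" for k
    by (rule ideal_mult_unit[OF fractional_ideal_A[OF D that assms(3)]])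
  then show ?thesis using True assms(2) ideal_mult_commute[of _ O_R] by (auto simp: ideal_A_0)
next
  case False
  \<comment> \<open>Both exponents are now positive, so \<open>i + j \<le> n\<close> yields the
    bound \<open>n \<ge> 2\<close> required for coprimality with the trace.\<close>
  then have "bezout (Z ^ i) (2 * Y)" using assms(2) by (intro bezout_trace_if_squarefree[OF D]) auto
  then obtain a b where ab: "a * Z ^ i + b * (2 * Y) = 1" unfolding bezout_def by blast
  have ij: "Z ^ (i + j) * Z ^ (n - i - j) = Z ^ n" using assms(2) by (simp flip: power_add)
  let ?M = "ideal_mult (ideal_A Y Z i) (ideal_A Y Z j)"
  have frac: "fractional_ideal D (ideal_A Y Z (i + j))" by (rule fractional_ideal_A) fact+
  show ?thesis
  proof
    show "?M \<subseteq> ideal_A Y Z (i + j)"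
    proof (rule ideal_mult_least)
      fix x y assume "x \<in> ideal_A Y Z i" "y \<in> ideal_A Y Z j"
      then obtain p q p' q' where eqs: "x = quad_R D p q" "y = quad_R D p' q'"
        and dv: "Z ^ i dvd p - Y * q" "Z ^ j dvd p' - Y * q'"
        unfolding ideal_A_def by blast
      have "Z ^ (i + j) dvd (p - Y * q) * (p' - Y * q')" using mult_dvd_mono[OF dv] by (simp add: power_add)
      moreover have "Z ^ (i + j) dvd E * q * q' * Z ^ n"
        using assms(2) by (intro dvd_mult le_imp_power_dvd)
      ultimately have "Z ^ (i + j) dvd (p - Y * q) * (p' - Y * q') - E * q * q' * Z ^ n" by (rule dvd_diff)
      also have "(p - Y * q) * (p' - Y * q') - E * q * q' * Z ^ n
          = (p * p' + D * q * q') - Y * (p * q' + q * p')"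
        unfolding D by (simp add: algebra_simps power2_eq_square)
      finally show "x * y \<in> ideal_A Y Z (i + j)" by (simp only: eqs quad_R_mult quad_R_in_ideal_A)
    qed (use frac in \<open>auto simp: fractional_ideal_def\<close>)
    show "ideal_A Y Z (i + j) \<subseteq> ?M"
    proof
      fix x assume "x \<in> ideal_A Y Z (i + j)"
      then obtain p q where x: "x = quad_R D p q" "Z ^ (i + j) dvd p - Y * q" unfolding ideal_A_def by blast
      obtain k where k: "p - Y * q = Z ^ (i + j) * k" using x(2) by (rule dvdE)
      \<comment> \<open>The first two products below add up to
        \<open>q * (Y + sqrt D) - b * q * E * Z ^ n\<close>; the third has to supply
        \<open>Z ^ (i + j) * k\<close> and compensate the term in \<open>Z ^ n\<close>.\<close>
      define t where "t = k + b * q * E * Z ^ (n - i - j)"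
      have "quad_R D (Z ^ i) 0 * quad_R D (Y * (a * q)) (a * q) \<in> ?M"
        "quad_R D Y 1 * quad_R D (Y * (b * q)) (b * q) \<in> ?M"
        "quad_R D (Z ^ i) 0 * quad_R D (Z ^ j * t) 0 \<in> ?M"
        by (intro ideal_mult_prod; simp add: quad_R_in_ideal_A del: to_fract_0 to_fract_1 to_fract_mult)+
      then have "quad_R D (Z ^ i) 0 * quad_R D (Y * (a * q)) (a * q)
          + quad_R D Y 1 * quad_R D (Y * (b * q)) (b * q)
          + quad_R D (Z ^ i) 0 * quad_R D (Z ^ j * t) 0 \<in> ?M"
        by (intro ideal_mult_add)
      also have "quad_R D (Z ^ i) 0 * quad_R D (Y * (a * q)) (a * q)
          + quad_R D Y 1 * quad_R D (Y * (b * q)) (b * q)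
          + quad_R D (Z ^ i) 0 * quad_R D (Z ^ j * t) 0 = x"
        unfolding quad_R_mult quad_R_add x quad_R_eq_iff
      proof
        have "Z ^ i * (Y * (a * q)) + D * 0 * (a * q) + (Y * (Y * (b * q)) + D * 1 * (b * q)) +
            (Z ^ i * (Z ^ j * t) + D * 0 * 0)
          = Y * q * (a * Z ^ i + b * (2 * Y)) + Z ^ (i + j) * k
            + b * q * E * (Z ^ (i + j) * Z ^ (n - i - j) - Z ^ n)"
          unfolding D t_def by (simp add: algebra_simps power2_eq_square power_add)
        then show "Z ^ i * (Y * (a * q)) + D * 0 * (a * q) + (Y * (Y * (b * q)) + D * 1 * (b * q)) +
            (Z ^ i * (Z ^ j * t) + D * 0 * 0) = p"
          using k by (simp only: ab ij) (simp add: algebra_simps)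
        have "Z ^ i * (a * q) + 0 * (Y * (a * q)) + (Y * (b * q) + 1 * (Y * (b * q))) +
            (Z ^ i * 0 + 0 * (Z ^ j * t)) = q * (a * Z ^ i + b * (2 * Y))"
          by (simp add: algebra_simps)
        then show "Z ^ i * (a * q) + 0 * (Y * (a * q)) + (Y * (b * q) + 1 * (Y * (b * q))) +
            (Z ^ i * 0 + 0 * (Z ^ j * t)) = q" by (simp only: ab mult_1_right)
      qed
      finally show "x \<in> ?M" .
    qed
  qed
qed

lemma ideal_A_nonprincipal:
  assumes D: "D = Y ^ 2 - E * Z ^ n" and m: "0 < m" "m < n"
    and S: "D = S ^ 2 + F" "F dvd S" "S \<noteq> 0" "Polynomial.degree S = n * Polynomial.degree Z"
    and Z: "Polynomial.degree Z > 0" "bezout F Z"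
  shows "ideal_A Y Z m \<notin> ideal_class O_R"
proof
  assume "ideal_A Y Z m \<in> ideal_class O_R"
  then obtain x where x: "ideal_A Y Z m = scale x O_R" unfolding ideal_class_def by blast
  have "x \<in> ideal_A Y Z m" unfolding x scale_def using O_R_0_1(2) by force
  then obtain p q where pq: "x = quad_R D p q" "Z ^ m dvd p - Y * q" unfolding ideal_A_def by blast
  have "quad_R D (Z ^ m) 0 \<in> ideal_A Y Z m" by (simp add: quad_R_in_ideal_A del: to_fract_0)
  then obtain y1 y2 where "quad_R D (Z ^ m) 0 = quad_R D p q * quad_R D y1 y2"
    unfolding x pq scale_def O_R_def by blast
  then have y: "p * y1 + D * q * y2 = Z ^ m" "p * y2 + q * y1 = 0"
    unfolding quad_R_mult quad_R_eq_iff by simp_all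
  have "quad_R D Y 1 \<in> ideal_A Y Z m" by (simp add: quad_R_in_ideal_A del: to_fract_1)
  then obtain w1 w2 where "quad_R D Y 1 = quad_R D p q * quad_R D w1 w2"
    unfolding x pq scale_def O_R_def by blast
  then have w: "p * w1 + D * q * w2 = Y" "p * w2 + q * w1 = 1"
    unfolding quad_R_mult quad_R_eq_iff by simp_all
  \<comment> \<open>The generator is primitive because the ideal contains \<open>Y + sqrt D\<close>,
    whose second coordinate is 1.\<close>
  have "w2 * p + w1 * q = 1" using w(2) by (simp add: mult.commute)
  then have coprime: "bezout p q" unfolding bezout_def by blast
  define N where "N = p ^ 2 - D * q ^ 2"
  have "bezout (Z ^ m) (2 * Y)" using m by (intro bezout_trace_if_squarefree[OF D]) auto
  then obtain a b where ab: "a * Z ^ m + b * (2 * Y) = 1" unfolding bezout_def by blast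
  \<comment> \<open>Taking the norm of \<open>Z ^ m\<close>, and then the first coordinate of
    \<open>Z ^ m\<close> times the conjugate of \<open>Y + sqrt D\<close>, shows that
    \<open>N\<close> divides \<open>Z ^ m * Z ^ m\<close> and \<open>Z ^ m * Y\<close>. The relation
    \<open>ab\<close> combines these to \<open>N dvd Z ^ m\<close>.\<close>
  have "N * (y1 ^ 2 - D * y2 ^ 2) = (p * y1 + D * q * y2) ^ 2 - D * (p * y2 + q * y1) ^ 2"
    by (simp add: N_def algebra_simps power2_eq_square)
  then have Ny: "N * (y1 ^ 2 - D * y2 ^ 2) = Z ^ m * Z ^ m" unfolding y by (simp add: power2_eq_square)
  have "N * (y1 * w1 - D * y2 * w2)
      = (p * y1 + D * q * y2) * (p * w1 + D * q * w2) - D * (p * y2 + q * y1) * (p * w2 + q * w1)"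
    by (simp add: N_def algebra_simps power2_eq_square)
  then have Nyw: "N * (y1 * w1 - D * y2 * w2) = Z ^ m * Y" unfolding y w by simp
  have "N * (a * (y1 ^ 2 - D * y2 ^ 2) + 2 * b * (y1 * w1 - D * y2 * w2))
      = a * (N * (y1 ^ 2 - D * y2 ^ 2)) + 2 * b * (N * (y1 * w1 - D * y2 * w2))"
    by (simp add: distrib_left mult_ac)
  also have "\<dots> = Z ^ m * (a * Z ^ m + b * (2 * Y))"
    unfolding Ny Nyw by (simp add: distrib_left mult_ac)
  also have "\<dots> = Z ^ m" by (simp only: ab mult_1_right)
  finally have "N dvd Z ^ m" by (metis dvd_triv_left)
  moreover have Z0: "Z \<noteq> 0" using Z(1) by auto
  ultimately have "Polynomial.degree N \<le> m * Polynomial.degree Z"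
    using dvd_imp_degree_le[of N "Z ^ m"] by (simp add: degree_power_eq)
  also have "\<dots> < Polynomial.degree S" using m(2) Z(1) S(4) by simp
  finally have "N dvd F" using small_norm_dvd[OF S(2,3) two coprime] by (simp add: N_def S(1))
  moreover have "Z ^ m dvd N"
  proof -
    \<comment> \<open>Modulo \<open>Z ^ n\<close> the norm factors, since \<open>D\<close> is
      congruent to \<open>Y ^ 2\<close>; membership in the ideal makes the first factor divisible by
      \<open>Z ^ m\<close>.\<close>
    have "Z ^ m dvd (p - Y * q) * (p + Y * q) + E * q ^ 2 * Z ^ n"
      by (rule dvd_add[OF dvd_mult2[OF pq(2)] dvd_mult[OF le_imp_power_dvd[OF less_imp_le[OF m(2)]]]])
    also have "(p - Y * q) * (p + Y * q) + E * q ^ 2 * Z ^ n = N"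
      unfolding N_def D by (simp add: algebra_simps power2_eq_square)
    finally show ?thesis .
  qed
  ultimately have "Z ^ m dvd F" by (rule dvd_trans[rotated])
  moreover have "bezout (Z ^ m) F" using Z(2) by (intro bezout_power_left) (rule bezout_sym)
  ultimately have "Z ^ m dvd 1" by (rule bezout_self_dvd[rotated])
  then have "Polynomial.degree (Z ^ m) = 0" using Z0 is_unit_iff_degree[of "Z ^ m"] by simp
  then show False using m(1) Z Z0 by (simp add: degree_power_eq)
qed

lemma has_subgroup_of_order_if_norm_and_small_unit:
  assumes D: "D = Y ^ 2 - E * Z ^ n" and E: "E dvd 1" and n: "n > 0"
    and S: "D = S ^ 2 + F" "F dvd S" "S \<noteq> 0" "Polynomial.degree S = n * Polynomial.degree Z"
    and Z: "Polynomial.degree Z > 0" "bezout F Z"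
  shows "has_subgroup_of_order (class_group D) n"
proof (rule has_subgroup_of_order_if_minimal_principal_power[where A = "ideal_A Y Z" and \<alpha> = "quad_R D Y 1"])
  have Z0: "Z \<noteq> 0" using Z(1) by auto
  show "fractional_ideal D (ideal_A Y Z i)" if "i \<le> n" for i
    using fractional_ideal_A[OF D that Z0] .
  show "ideal_mult (ideal_A Y Z i) (ideal_A Y Z j) = ideal_A Y Z (i + j)" if "i + j \<le> n" for i j
    using ideal_A_mult[OF D that Z0] .
  show "ideal_A Y Z m \<notin> ideal_class O_R" if "0 < m" "m < n" for m
    using ideal_A_nonprincipal[OF D that S Z] .
  show "quad_R D Y 1 \<in> quad_field D" unfolding quad_field_eq by blast
  show "quad_R D Y 1 \<noteq> 0" by (simp add: quad_eq_0_iff)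
qed (use n ideal_A_0 ideal_A_principal[OF D E] in auto)

end

section \<open>The families of polynomials \<open>D\<close> and their two representations\<close>

lemma two_neq_zero_if_odd_card:
  assumes "odd (card (UNIV :: 'a::{field,finite} set))"
  shows "(2::'a) \<noteq> 0"
proof
  assume "(2::'a) = 0"
  then have "of_nat 2 = (0::'a)" by simp
  then have "CHAR('a) dvd 2" by (simp only: of_nat_eq_0_iff_char_dvd)
  then have "CHAR('a) = 1 \<or> CHAR('a) = 2" by (meson prime_nat_iff two_is_prime_nat)
  moreover have "CHAR('a) \<noteq> 1" by simp
  ultimately have "2 dvd card (UNIV :: 'a set)" using CHAR_dvd_CARD[where 'a = 'a] by simp
  then show False using assms by simp
qed

text \<open>A common form of all the families, with unit parameters \<open>u\<close>,
  \<open>a\<close>, \<open>b\<close>. For \<open>S = u * Z ^ n + a * F - b\<close> the identity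
  \<open>S ^ 2 + 4 * a * b * F = (S + 2 * b) ^ 2 - 4 * b * u * Z ^ n\<close> supplies both
  representations.\<close>

lemma class_group_has_subgroup_of_order:
  fixes Z F u a b :: "'a::field poly"
  assumes two: "(2::'a) \<noteq> 0" and n: "n > 0" and Z: "Polynomial.degree Z > 0"
    and units: "u dvd 1" "a dvd 1" "b dvd 1"
    and F: "F dvd u * Z ^ n - b" and S0: "u * Z ^ n + a * F - b \<noteq> 0"
    and D: "D = (u * Z ^ n + a * F - b) ^ 2 + 4 * a * b * F"
    and lc: "Polynomial.lead_coeff D = 1" and sqfree: "squarefree D"
  shows "real_quadratic D \<and> has_subgroup_of_order (class_group D) n"
proof -
  define W where "W = u * Z ^ n - b"
  define S where "S = u * Z ^ n + a * F - b"
  define F' where "F' = 4 * a * b * F"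
  define Y where "Y = u * Z ^ n + a * F + b"
  have Z0: "Z \<noteq> 0" using Z by auto
  have unit_deg: "c \<noteq> 0" "Polynomial.degree c = 0" if "c dvd 1" for c :: "'a poly"
  proof -
    show "c \<noteq> 0" using that by auto
    then show "Polynomial.degree c = 0" using that is_unit_iff_degree by blast
  qed
  obtain h where h: "2 * h = (1 :: 'a poly)" using two two_invertible_poly by blast
  have "(4 :: 'a poly) * (h * h) = (2 * h) * (2 * h)" by simp
  then have four: "(4 :: 'a poly) dvd 1" unfolding h by (metis dvd_triv_left mult_1)
  have c: "4 * a * b dvd 1" "4 * b * u dvd 1"
    using four units by (simp_all only: is_unit_mult_iff)
  have degW: "Polynomial.degree W = n * Polynomial.degree Z"
  proof -
    have "Polynomial.degree (u * Z ^ n) = n * Polynomial.degree Z"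
      using unit_deg[OF units(1)] Z0 by (simp add: degree_mult_eq degree_power_eq)
    moreover have "Polynomial.degree (u * Z ^ n + - b) = Polynomial.degree (u * Z ^ n)"
      by (rule degree_add_eq_left) (use calculation unit_deg[OF units(3)] n Z in simp)
    ultimately show ?thesis by (simp add: W_def)
  qed
  obtain V where V: "W = F * V" using F unfolding W_def by (rule dvdE)
  have W0: "W \<noteq> 0" using degW n Z by auto
  have SV: "S = F * (V + a)" using V by (simp add: S_def W_def algebra_simps)
  \<comment> \<open>Adding a unit does not change the degree of a nonconstant \<open>V\<close>, and
    for constant \<open>V\<close> both degrees are 0. As \<open>S \<noteq> 0\<close> rules out
    \<open>V = - a\<close>, the degrees of \<open>S\<close> and \<open>W\<close> then agree.\<close>
  have "Polynomial.degree (V + a) = Polynomial.degree V"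
  proof (cases "Polynomial.degree V = 0")
    case True
    then show ?thesis using unit_deg[OF units(2)] degree_add_le[of V 0 a] by simp
  next
    case False
    then show ?thesis using unit_deg[OF units(2)] by (intro degree_add_eq_left) simp
  qed
  moreover have "S \<noteq> 0" using S0 by (simp add: S_def)
  ultimately have degS: "Polynomial.degree S = n * Polynomial.degree Z"
    using SV V W0 degW by (metis degree_mult_eq mult_eq_0_iff)
  obtain c' where c': "1 = 4 * a * b * c'" using c(1) by (rule dvdE)
  have "F = F' * c'" using c' by (simp add: F'_def mult_ac)
  then have F'F: "F' dvd F" by simp
  have DS: "D = S ^ 2 + F'" by (simp add: D S_def F'_def)
  have F'S: "F' dvd S" using F'F SV by (metis dvd_mult2)
  have DX: "D = Y ^ 2 - (4 * b * u) * Z ^ n"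
    by (simp add: D Y_def power2_eq_square algebra_simps)
  obtain b' where b': "1 = b * b'" using units(3) by (rule dvdE)
  \<comment> \<open>Modulo \<open>Z\<close> the polynomial \<open>W\<close> reduces to the unit
    \<open>- b\<close>; \<open>n > 0\<close> allows one factor \<open>Z\<close> to be taken out of
    \<open>Z ^ n\<close>.\<close>
  have "(- b') * W + (b' * u * Z ^ (n - 1)) * Z = b * b' + b' * u * (Z ^ (n - 1) * Z - Z ^ n)"
    by (simp add: W_def algebra_simps)
  also have "\<dots> = 1" using n b' by (simp add: power_eq_if mult.commute)
  finally have "bezout W Z" unfolding bezout_def by blast
  then have bz: "bezout F' Z" by (rule bezout_dvd_left) (use F'F V in \<open>metis dvd_mult2\<close>)
  have degD: "Polynomial.degree D = 2 * Polynomial.degree S"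
  proof -
    \<comment> \<open>As a divisor of \<open>S\<close>, the summand \<open>F'\<close> cannot affect
      the leading term of \<open>S ^ 2\<close>; hence the degree of \<open>D\<close> is positive and
      even.\<close>
    have "Polynomial.degree F' \<le> Polynomial.degree S" using F'S \<open>S \<noteq> 0\<close> by (rule dvd_imp_degree_le)
    moreover have "0 < Polynomial.degree S" using degS n Z by simp
    ultimately have "Polynomial.degree (S ^ 2 + F') = Polynomial.degree (S ^ 2)"
      using \<open>S \<noteq> 0\<close> by (intro degree_add_eq_left) (simp add: degree_power_eq)
    then show ?thesis using DS \<open>S \<noteq> 0\<close> by (simp add: degree_power_eq)
  qed
  have degD_pos: "Polynomial.degree D > 0" using degD degS n Z by simp
  interpret quadratic D by standard fact+
  have "has_subgroup_of_order (class_group D) n"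
    by (rule has_subgroup_of_order_if_norm_and_small_unit[OF DX c(2) n DS F'S \<open>S \<noteq> 0\<close> degS Z bz])
  moreover have "real_quadratic D"
    unfolding real_quadratic_def using degD_pos degD sqfree lc by (auto intro!: exI[of _ 1])
  ultimately show ?thesis by blast
qed

theorem theorem2:
  fixes n :: nat and Z :: "'a::{field,finite} poly"
  assumes "odd (card (UNIV :: 'a set))" and "n > 0" and "Polynomial.degree Z > 0"
  shows
    "(\<forall>D. D = Z ^ (2 * n) + 1 \<and> Polynomial.lead_coeff D = 1 \<and> squarefree D \<longrightarrow>
        real_quadratic D \<and> has_subgroup_of_order (class_group D) n)
   \<and> (\<forall>F D. F dvd Z ^ n - 1 \<and> Z ^ n + F - 1 \<noteq> 0 \<and>
        D = (Z ^ n + F - 1) ^ 2 + 4 * F \<and> Polynomial.lead_coeff D = 1 \<and> squarefree D \<longrightarrow>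
        real_quadratic D \<and> has_subgroup_of_order (class_group D) n)
   \<and> (\<forall>F D. F dvd Z ^ n + 1 \<and> Z ^ n - F + 1 \<noteq> 0 \<and>
        D = (Z ^ n - F + 1) ^ 2 + 4 * F \<and> Polynomial.lead_coeff D = 1 \<and> squarefree D \<longrightarrow>
        real_quadratic D \<and> has_subgroup_of_order (class_group D) n)
   \<and> (\<forall>F D. F dvd 4 * Z ^ n - 1 \<and> 4 * Z ^ n + F - 1 \<noteq> 0 \<and>
        D = (4 * Z ^ n + F - 1) ^ 2 + 4 * F \<and> Polynomial.lead_coeff D = 1 \<and> squarefree D \<longrightarrow>
        real_quadratic D \<and> has_subgroup_of_order (class_group D) n)
   \<and> (\<forall>a b F D. a \<noteq> 0 \<and> b \<noteq> 0 \<and> F dvd Z ^ n - [:b:] \<and> Z ^ n + [:a:] * F - [:b:] \<noteq> 0 \<and>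
        D = (Z ^ n + [:a:] * F - [:b:]) ^ 2 + 4 * [:a:] * [:b:] * F \<and>
        Polynomial.lead_coeff D = 1 \<and> squarefree D \<longrightarrow>
        real_quadratic D \<and> has_subgroup_of_order (class_group D) n)"
proof -
  have two: "(2::'a) \<noteq> 0" by (rule two_neq_zero_if_odd_card) fact
  note main = class_group_has_subgroup_of_order[OF two assms(2,3)]
  obtain h where h: "2 * h = (1 :: 'a poly)" using two two_invertible_poly by blast
  then have h_unit: "h dvd 1" by (metis dvd_triv_right)
  have hh: "4 * h * h = 1"
  proof -
    have "4 * h * h = (2 * h) * (2 * h)" by simp
    then show ?thesis unfolding h by simp
  qed
  then have four: "(4 :: 'a poly) dvd 1" by (metis dvd_triv_left mult.assoc)
  have Z0: "Z ^ n \<noteq> 0" using assms(3) by auto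
  have "real_quadratic D \<and> has_subgroup_of_order (class_group D) n"
    if "D = Z ^ (2 * n) + 1 \<and> Polynomial.lead_coeff D = 1 \<and> squarefree D" for D
    \<comment> \<open>Here \<open>h\<close> is one half: for \<open>a = 1\<close> and
      \<open>b = F = h\<close> the terms \<open>a * F\<close> and \<open>b\<close> cancel, and
      \<open>4 * a * b * F = 1\<close>.\<close>
    by (rule main[of 1 1 h h])
      (use that h_unit hh Z0 assms(2) in \<open>auto simp: power_mult power2_eq_square mult_2 power_add\<close>)
  moreover have "real_quadratic D \<and> has_subgroup_of_order (class_group D) n"
    if "F dvd Z ^ n - 1 \<and> Z ^ n + F - 1 \<noteq> 0 \<and> D = (Z ^ n + F - 1) ^ 2 + 4 * F
      \<and> Polynomial.lead_coeff D = 1 \<and> squarefree D" for F D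
    by (rule main[of 1 1 1 F]) (use that in auto)
  moreover have "real_quadratic D \<and> has_subgroup_of_order (class_group D) n"
    if "F dvd Z ^ n + 1 \<and> Z ^ n - F + 1 \<noteq> 0 \<and> D = (Z ^ n - F + 1) ^ 2 + 4 * F
      \<and> Polynomial.lead_coeff D = 1 \<and> squarefree D" for F D
    \<comment> \<open>Taking \<open>a = b = -1\<close> flips the signs inside the square and leaves
      \<open>4 * a * b * F = 4 * F\<close>.\<close>
    by (rule main[of 1 "-1" "-1" F]) (use that in auto)
  moreover have "real_quadratic D \<and> has_subgroup_of_order (class_group D) n"
    if "F dvd 4 * Z ^ n - 1 \<and> 4 * Z ^ n + F - 1 \<noteq> 0 \<and> D = (4 * Z ^ n + F - 1) ^ 2 + 4 * F
      \<and> Polynomial.lead_coeff D = 1 \<and> squarefree D" for F D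
    \<comment> \<open>The factor 4 in front of \<open>Z ^ n\<close> plays the part of
      \<open>u\<close>; it is a unit because 2 is invertible.\<close>
    by (rule main[of 4 1 1 F]) (use that four in auto)
  moreover have "real_quadratic D \<and> has_subgroup_of_order (class_group D) n"
    if "a \<noteq> 0 \<and> b \<noteq> 0 \<and> F dvd Z ^ n - [:b:] \<and> Z ^ n + [:a:] * F - [:b:] \<noteq> 0 \<and>
        D = (Z ^ n + [:a:] * F - [:b:]) ^ 2 + 4 * [:a:] * [:b:] * F \<and>
        Polynomial.lead_coeff D = 1 \<and> squarefree D" for a b F D
  proof (rule main[of 1 "[:a:]" "[:b:]" F, unfolded mult_1])
    show "1 dvd (1 :: 'a poly)" "[:a:] dvd 1" "[:b:] dvd 1"
      using that by (simp_all add: is_unit_const_poly_iff dvd_field_iff)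
  qed (use that in blast)+
  ultimately show ?thesis by blast
qed

end
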